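(* Let $a,b>0$, $\gamma,\widetilde\gamma\in\mathbb{R}$, $\theta_2\in[-\pi,\pi]$, and put $\tau=\cos\theta_2$. Let $E\in(0,\infty)\setminus\sigma(\mathscr{H}_\gamma^{\theta_2})$ and $k=E^{1/2}$. Then $E\in\sigma_{\rm disc}(\mathscr{H}_{\gamma,\widetilde\gamma}^{\theta_2})$ if and only if $$ f_{\widetilde\gamma}^\tau(k)=\begin{cases} f_\gamma^\tau(k)+\sqrt{(f_\gamma^\tau(k))^2-1}, & \text{provided } f_\gamma^\tau(k)<-1,\\[2pt] f_\gamma^\tau(k)-\sqrt{(f_\gamma^\tau(k))^2-1}, & \text{provided } f_\gamma^\tau(k)>1.\end{cases} $$
   Context: Let $\Gamma_0$ be the infinite comb graph with vertices $x_j=(ja,0)$, $j\in\mathbb{Z}$, edges of length $a$ joining $x_{j-1}$ and $x_j$, and, for each $j$, two edges of length $b/2$ joining $x_j$ to $x_j^+=(ja,b/2)$ and to $x_j^-=(ja,-b/2)$. For $\gamma,\widetilde\gamma\in\mathbb{R}$ and $\theta_2\in[-\pi,\pi]$, $\mathscr{H}_{\gamma,\widetilde\gamma}^{\theta_2}$ is the self-adjoint operator in $L^2(\Gamma_0)$ acting as $-\frac{d^2}{dx^2}$ on each edge (functions in $H^2$ on each edge), with a $\delta$-coupling at each internal vertex $x_j$ (continuity of $\psi$ at $x_j$, and the sum of the derivatives of $\psi$ at $x_j$ taken in the outward directions of the edges emanating from $x_j$ equals $c_j\psi(x_j)$), where $c_0=\widetilde\gamma$ and $c_j=\gamma$ for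 $j\neq0$, and with the quasi-periodic conditions $\psi(x_j^+)=e^{i\theta_2}\psi(x_j^-)$, $\psi'(x_j^+)=e^{i\theta_2}\psi'(x_j^-)$ at the degree-one vertices (derivatives on the vertical edges taken with respect to the upward coordinate). Set $\mathscr{H}_\gamma^{\theta_2}:=\mathscr{H}_{\gamma,\gamma}^{\theta_2}$. Let $\Xi=\{k>0:\ \sin(ka)\sin(kb)=0\}$ and, for $\gamma\in\mathbb{R}$, $\tau\in[-1,1]$, define $f_\gamma^\tau:(0,\infty)\setminus\Xi\to\mathbb{R}$ by $$f_\gamma^\tau(k)=\frac{\gamma\sin ka}{2k}+\frac{\sin k(a+b)}{\sin kb}-\tau\frac{\sin ka}{\sin kb}.$$ For $E=k^2>0$ one has $E\in\sigma(\mathscr{H}_\gamma^{\theta_2})$ iff $|f_\gamma^{\cos\theta_2}(k)|\le1$; in particular $E\in(0,\infty)\setminus\sigma(\mathscr{H}_\gamma^{\theta_2})$ means $|f_\gamma^{\cos\theta_2}(k)|>1$. *)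

theory Defs
  imports "HOL-Analysis.Analysis"
begin

text \<open>Edges of the comb graph: for each j :: int there is the horizontal edge
 (Hor, j) of length a joining x_(j-1) (parameter 0) to x_j (parameter a), the upper
 vertical edge (Up, j) of length b/2 joining x_j (parameter 0) to x_j^+ (parameter b/2),
 and the lower vertical edge (Dn, j) of length b/2 joining x_j^- (parameter 0) to x_j
 (parameter b/2); vertical edges are parametrised by the upward coordinate.
 A function on the graph is psi :: int => etype => real => complex, psi j e restricted
 to [0, elen a b e].\<close>

datatype etype = Hor | Up | Dn

definition elen :: "real \<Rightarrow> real \<Rightarrow> etype \<Rightarrow> real" where
  "elen a b e = (case e of Hor \<Rightarrow> a | Up \<Rightarrow> b / 2 | Dn \<Rightarrow> b / 2)"

definition sqint :: "real \<Rightarrow> (real \<Rightarrow> complex) \<Rightarrow> bool" where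
  "sqint l u \<longleftrightarrow> set_borel_measurable lborel {0..l} u \<and>
     set_integrable lborel {0..l} (\<lambda>t. (cmod (u t))^2)"

text \<open>u belongs to H^2(0,l) and w is (a representative of) its second derivative:
 u is C^1 on [0,l] and u' is the indefinite Lebesgue integral of the L^2 function w.\<close>
definition H2sol :: "real \<Rightarrow> (real \<Rightarrow> complex) \<Rightarrow> (real \<Rightarrow> complex) \<Rightarrow> bool" where
  "H2sol l u w \<longleftrightarrow> sqint l w \<and>
     (\<exists>u'. (\<forall>t\<in>{0..l}. (u has_vector_derivative u' t) (at t within {0..l})) \<and>
           (\<forall>t\<in>{0..l}. u' t = u' 0 + (LINT s:{0..t}|lborel. w s)))"

definition edge_norm2 :: "real \<Rightarrow> (real \<Rightarrow> complex) \<Rightarrow> real" where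
  "edge_norm2 l u = (LINT t:{0..l}|lborel. (cmod (u t))^2)"

definition L2g :: "real \<Rightarrow> real \<Rightarrow> (int \<Rightarrow> etype \<Rightarrow> real \<Rightarrow> complex) \<Rightarrow> bool" where
  "L2g a b psi \<longleftrightarrow> (\<forall>j e. sqint (elen a b e) (psi j e)) \<and>
     (\<lambda>j. edge_norm2 a (psi j Hor) + edge_norm2 (b/2) (psi j Up) + edge_norm2 (b/2) (psi j Dn))
        summable_on (UNIV :: int set)"

definition dv :: "real \<Rightarrow> (real \<Rightarrow> complex) \<Rightarrow> real \<Rightarrow> complex" where
  "dv l u t = vector_derivative u (at t within {0..l})"

definition vertex_conds ::
  "real \<Rightarrow> real \<Rightarrow> (int \<Rightarrow> real) \<Rightarrow> real \<Rightarrow> (int \<Rightarrow> etype \<Rightarrow> real \<Rightarrow> complex) \<Rightarrow> bool" where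
  "vertex_conds a b c theta psi \<longleftrightarrow> (\<forall>j::int.
      psi j Hor a = psi (j+1) Hor 0 \<and> psi (j+1) Hor 0 = psi j Up 0 \<and> psi j Up 0 = psi j Dn (b/2) \<and>
      - dv a (psi j Hor) a + dv a (psi (j+1) Hor) 0 + dv (b/2) (psi j Up) 0 - dv (b/2) (psi j Dn) (b/2)
        = complex_of_real (c j) * psi j Up 0 \<and>
      psi j Up (b/2) = exp (\<i> * complex_of_real theta) * psi j Dn 0 \<and>
      dv (b/2) (psi j Up) (b/2) = exp (\<i> * complex_of_real theta) * dv (b/2) (psi j Dn) 0)"

text \<open>psi is in the operator domain and (H - E) psi = g (i.e. -psi'' = g + E psi on each edge)\<close>
definition solves ::
  "real \<Rightarrow> real \<Rightarrow> (int \<Rightarrow> real) \<Rightarrow> real \<Rightarrow> complex \<Rightarrow> (int \<Rightarrow> etype \<Rightarrow> real \<Rightarrow> complex)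
     \<Rightarrow> (int \<Rightarrow> etype \<Rightarrow> real \<Rightarrow> complex) \<Rightarrow> bool" where
  "solves a b c theta E psi g \<longleftrightarrow> L2g a b psi \<and>
     (\<forall>j e. H2sol (elen a b e) (psi j e) (\<lambda>t. - (g j e t + E * psi j e t))) \<and>
     vertex_conds a b c theta psi"

definition zero_on_edges :: "real \<Rightarrow> real \<Rightarrow> (int \<Rightarrow> etype \<Rightarrow> real \<Rightarrow> complex) \<Rightarrow> bool" where
  "zero_on_edges a b psi \<longleftrightarrow> (\<forall>j e. \<forall>t\<in>{0..elen a b e}. psi j e t = 0)"

text \<open>spectrum: E is in the resolvent set iff H - E is a bijection from the domain onto
 L^2 (for the closed operator H the inverse is then automatically bounded)\<close>
definition specH :: "real \<Rightarrow> real \<Rightarrow> (int \<Rightarrow> real) \<Rightarrow> real \<Rightarrow> complex set" where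
  "specH a b c theta = {E. \<not> ((\<forall>g. L2g a b g \<longrightarrow> (\<exists>psi. solves a b c theta E psi g)) \<and>
      (\<forall>psi. solves a b c theta E psi (\<lambda>_ _ _. 0) \<longrightarrow> zero_on_edges a b psi))}"

definition eigsp :: "real \<Rightarrow> real \<Rightarrow> (int \<Rightarrow> real) \<Rightarrow> real \<Rightarrow> complex
    \<Rightarrow> (int \<Rightarrow> etype \<Rightarrow> real \<Rightarrow> complex) set" where
  "eigsp a b c theta E = {psi. solves a b c theta E psi (\<lambda>_ _ _. 0)}"

definition disc_specH :: "real \<Rightarrow> real \<Rightarrow> (int \<Rightarrow> real) \<Rightarrow> real \<Rightarrow> complex set" where
  "disc_specH a b c theta = {E \<in> specH a b c theta.
     (\<exists>\<epsilon>>0. \<forall>\<mu>. \<mu> \<noteq> E \<and> cmod (\<mu> - E) < \<epsilon> \<longrightarrow> \<mu> \<notin> specH a b c theta) \<and>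
     (\<exists>psi\<in>eigsp a b c theta E. \<not> zero_on_edges a b psi) \<and>
     (\<exists>F. finite F \<and> F \<subseteq> eigsp a b c theta E \<and>
        (\<forall>psi\<in>eigsp a b c theta E. \<exists>co. \<forall>j e. \<forall>t\<in>{0..elen a b e}.
            psi j e t = (\<Sum>phi\<in>F. co phi * phi j e t)))}"

definition coup :: "real \<Rightarrow> real \<Rightarrow> int \<Rightarrow> real" where
  "coup \<gamma> \<gamma>t j = (if j = 0 then \<gamma>t else \<gamma>)"

definition specHg :: "real \<Rightarrow> real \<Rightarrow> real \<Rightarrow> real \<Rightarrow> real \<Rightarrow> complex set" where
  "specHg a b \<gamma> \<gamma>t theta = specH a b (coup \<gamma> \<gamma>t) theta"

definition disc_specHg :: "real \<Rightarrow> real \<Rightarrow> real \<Rightarrow> real \<Rightarrow> real \<Rightarrow> complex set" where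
  "disc_specHg a b \<gamma> \<gamma>t theta = disc_specH a b (coup \<gamma> \<gamma>t) theta"

definition Xi :: "real \<Rightarrow> real \<Rightarrow> real set" where
  "Xi a b = {k. k > 0 \<and> sin (k * a) * sin (k * b) = 0}"

definition ff :: "real \<Rightarrow> real \<Rightarrow> real \<Rightarrow> real \<Rightarrow> real \<Rightarrow> real" where
  "ff a b \<gamma> \<tau> k = \<gamma> * sin (k * a) / (2 * k) + sin (k * (a + b)) / sin (k * b)
      - \<tau> * sin (k * a) / sin (k * b)"

end

theory Submission
  imports Defs "HOL-Complex_Analysis.Complex_Analysis" "HOL-Real_Asymp.Real_Asymp"
begin

text \<open>On an edge every solution of \<open>- u'' = g + \<kappa>\<^sup>2 u\<close> is a particular solution plus a combination of
  \<open>cos \<kappa>t\<close> and \<open>sin \<kappa>t / \<kappa>\<close>. Eliminating the edges turns \<open>(H - \<kappa>\<^sup>2) \<psi> = g\<close> into the three-term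
  recurrence \<open>y (j + 1) + y (j - 1) - 2 F\<^sub>j y j = h j\<close> for the vertex values \<open>y j = \<psi> (x\<^sub>j)\<close>, where
  \<open>F\<^sub>j\<close> is the discriminant \<open>f\<close> for the coupling at \<open>x\<^sub>j\<close>: \<open>F\<^sub>0 = Ft\<close> and \<open>F\<^sub>j = F\<close> otherwise. If \<open>F\<close>
  lies outside \<open>[-1, 1]\<close>, let \<open>z\<close> be the root of \<open>z + 1/z = 2 F\<close> with \<open>|z| < 1\<close>. A decaying solution of the
  homogeneous recurrence is a multiple of \<open>z\<^bsup>|j|\<^esup>\<close>, which satisfies the equation at \<open>j = 0\<close> exactly when
  \<open>Ft = z\<close>; otherwise the recurrence is uniquely solvable in \<open>\<ell>\<^sup>2\<close> and \<open>\<kappa>\<^sup>2\<close> is in the resolvent set.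
  If \<open>F \<in> [-1, 1]\<close> there are no decaying solutions on a half-line, so a source at a single vertex has
  no response and \<open>\<kappa>\<^sup>2\<close> is in the spectrum of the unperturbed operator. The equation \<open>Ft = z\<close> forces the
  meromorphic function \<open>Ft\<^sup>2 - 2 F Ft + 1\<close> of \<open>\<kappa>\<close> to vanish; it is nonzero far up the imaginary axis,
  so its zeros, and with them the eigenvalue, are isolated.\<close>

section \<open>Square-integrable functions on an edge\<close>

lemma (in finite_measure) power2_integral_le:
  fixes f :: "'a \<Rightarrow> real"
  assumes f [measurable]: "f \<in> borel_measurable M" and f2: "integrable M (\<lambda>x. (f x)\<^sup>2)"
  shows "(\<integral>x. f x \<partial>M)\<^sup>2 \<le> measure M (space M) * (\<integral>x. (f x)\<^sup>2 \<partial>M)"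
proof (cases "measure M (space M) = 0")
  case True
  then have "space M \<in> null_sets M" by (simp add: null_sets_def emeasure_eq_measure)
  then have "AE x in M. f x = 0" by (rule AE_I') auto
  then show ?thesis using True by (simp add: integral_eq_zero_AE)
next
  case False
  define v I where "v = measure M (space M)" and "I = (\<integral>x. f x \<partial>M)"
  have v: "v > 0" using False by (simp add: v_def zero_less_measure_iff measure_eq_0_null_sets)
  have f1: "integrable M f" by (rule square_integrable_imp_integrable[OF f f2])
  have "0 \<le> (\<integral>x. (v * f x - I)\<^sup>2 \<partial>M)" by (rule integral_nonneg_AE) simp
  also have "\<dots> = (\<integral>x. v\<^sup>2 * (f x)\<^sup>2 - 2 * v * I * f x + I\<^sup>2 \<partial>M)"
    by (simp add: power2_diff power_mult_distrib algebra_simps)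
  also have "\<dots> = v\<^sup>2 * (\<integral>x. (f x)\<^sup>2 \<partial>M) - 2 * v * I * I + v * I\<^sup>2"
    using f1 f2 by (simp add: I_def v_def)
  also have "\<dots> = v * (v * (\<integral>x. (f x)\<^sup>2 \<partial>M) - I\<^sup>2)"
    by (simp add: power2_eq_square algebra_simps)
  finally show ?thesis using v by (simp add: zero_le_mult_iff I_def v_def)
qed

abbreviation edge_measure :: "real \<Rightarrow> real measure" where
  "edge_measure l \<equiv> restrict_space lborel {0..l}"

lemma finite_measure_edge: "finite_measure (edge_measure l)"
  by (rule finite_measureI) (cases "0 \<le> l", simp_all add: emeasure_restrict_space)

lemma measure_edge: "0 \<le> l \<Longrightarrow> measure (edge_measure l) {0..l} = l"
  by (simp add: measure_restrict_space)

lemma sqint_iff: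
  "sqint l u \<longleftrightarrow> u \<in> borel_measurable (edge_measure l) \<and> integrable (edge_measure l) (\<lambda>t. (cmod (u t))\<^sup>2)"
  by (simp add: sqint_def set_borel_measurable_def set_integrable_def
      borel_measurable_restrict_space_iff integrable_restrict_space)

lemma edge_norm2_eq: "edge_norm2 l u = (\<integral>t. (cmod (u t))\<^sup>2 \<partial>edge_measure l)"
  by (simp add: edge_norm2_def set_lebesgue_integral_def integral_restrict_space)

lemma edge_norm2_nonneg: "0 \<le> edge_norm2 l u"
  unfolding edge_norm2_eq by (rule integral_nonneg_AE) simp

lemma edge_norm2_cong: "(\<And>t. t \<in> {0..l} \<Longrightarrow> u t = v t) \<Longrightarrow> edge_norm2 l u = edge_norm2 l v"
  unfolding edge_norm2_eq by (rule Bochner_Integration.integral_cong) auto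

lemma sqint_imp_set_integrable:
  assumes "sqint l u"
  shows "set_integrable lborel {0..l} u"
proof -
  interpret finite_measure "edge_measure l" by (rule finite_measure_edge)
  have m: "u \<in> borel_measurable (edge_measure l)" using assms by (simp add: sqint_iff)
  have "integrable (edge_measure l) (\<lambda>t. cmod (u t))"
    by (rule square_integrable_imp_integrable) (use assms in \<open>auto simp: sqint_iff\<close>)
  then have "integrable (edge_measure l) u" using m by (rule integrable_norm_cancel)
  then show ?thesis by (simp add: set_integrable_def integrable_restrict_space)
qed

lemma sqint_imp_integrable_on: "sqint l u \<Longrightarrow> u integrable_on {0..l}"
  using set_borel_integral_eq_integral(1) sqint_imp_set_integrable by blast

lemma sqint_if_continuous_on:
  assumes "continuous_on {0..l} u"
  shows "sqint l u"
proof -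
  have "continuous_on {0..l} (\<lambda>t. (cmod (u t))\<^sup>2)" by (intro continuous_intros assms)
  from this[THEN borel_integrable_atLeastAtMost'] assms[THEN borel_integrable_atLeastAtMost']
  show ?thesis by (auto simp: sqint_def set_borel_measurable_def set_integrable_def)
qed

lemma cmod_add_power2_le: "(cmod (x + y))\<^sup>2 \<le> 2 * ((cmod x)\<^sup>2 + (cmod y)\<^sup>2)"
proof -
  have "(cmod (x + y))\<^sup>2 \<le> (cmod x + cmod y)\<^sup>2" by (intro power_mono norm_triangle_ineq) auto
  also have "\<dots> \<le> 2 * ((cmod x)\<^sup>2 + (cmod y)\<^sup>2)"
    using zero_le_power2[of "cmod x - cmod y"] by (simp add: power2_sum power2_diff)
  finally show ?thesis .
qed

lemma sqint_cmult: "sqint l u \<Longrightarrow> sqint l (\<lambda>t. c * u t)"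
  by (auto simp: sqint_iff norm_mult power_mult_distrib)

lemma
  assumes "sqint l u" "sqint l v"
  shows sqint_add: "sqint l (\<lambda>t. u t + v t)"
    and edge_norm2_add_le: "edge_norm2 l (\<lambda>t. u t + v t) \<le> 2 * (edge_norm2 l u + edge_norm2 l v)"
proof -
  have [measurable]: "u \<in> borel_measurable (edge_measure l)" "v \<in> borel_measurable (edge_measure l)"
    and int: "integrable (edge_measure l) (\<lambda>t. (cmod (u t))\<^sup>2)"
      "integrable (edge_measure l) (\<lambda>t. (cmod (v t))\<^sup>2)"
    using assms by (simp_all add: sqint_iff)
  have bound: "integrable (edge_measure l) (\<lambda>t. 2 * ((cmod (u t))\<^sup>2 + (cmod (v t))\<^sup>2))"
    using int by simp
  have "integrable (edge_measure l) (\<lambda>t. (cmod (u t + v t))\<^sup>2)"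
    by (rule Bochner_Integration.integrable_bound[OF bound])
      (use cmod_add_power2_le in \<open>auto simp del: distrib_left_numeral\<close>)
  moreover from integral_mono[OF this bound cmod_add_power2_le]
  show "edge_norm2 l (\<lambda>t. u t + v t) \<le> 2 * (edge_norm2 l u + edge_norm2 l v)"
    using int by (simp add: edge_norm2_eq)
  ultimately show "sqint l (\<lambda>t. u t + v t)" by (simp add: sqint_iff)
qed

lemma edge_norm2_mult_le:
  assumes u: "sqint l u" and bound: "\<And>t. t \<in> {0..l} \<Longrightarrow> cmod (f t) \<le> M"
    and fu: "sqint l (\<lambda>t. f t * u t)"
  shows "edge_norm2 l (\<lambda>t. f t * u t) \<le> M\<^sup>2 * edge_norm2 l u"
proof -
  have "edge_norm2 l (\<lambda>t. f t * u t) \<le> (\<integral>t. M\<^sup>2 * (cmod (u t))\<^sup>2 \<partial>edge_measure l)"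
    unfolding edge_norm2_eq
  proof (rule integral_mono)
    fix t assume "t \<in> space (edge_measure l)"
    then have "(cmod (f t))\<^sup>2 \<le> M\<^sup>2" using bound by (intro power_mono) auto
    then show "(cmod (f t * u t))\<^sup>2 \<le> M\<^sup>2 * (cmod (u t))\<^sup>2"
      by (simp add: norm_mult power_mult_distrib mult_right_mono)
  qed (use u fu in \<open>auto simp: sqint_iff\<close>)
  then show ?thesis by (simp add: edge_norm2_eq)
qed

lemma edge_norm2_le:
  assumes "0 \<le> l" "sqint l u" "\<And>t. t \<in> {0..l} \<Longrightarrow> (cmod (u t))\<^sup>2 \<le> B"
  shows "edge_norm2 l u \<le> l * B"
proof -
  interpret finite_measure "edge_measure l" by (rule finite_measure_edge)
  have "edge_norm2 l u \<le> (\<integral>t. B \<partial>edge_measure l)"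
    unfolding edge_norm2_eq by (rule integral_mono) (use assms in \<open>auto simp: sqint_iff\<close>)
  also have "\<dots> = l * B" using measure_edge[OF assms(1)] by simp
  finally show ?thesis .
qed

definition prim :: "(real \<Rightarrow> complex) \<Rightarrow> real \<Rightarrow> complex" where
  "prim g t = integral {0..t} g"

lemma prim_0 [simp]: "prim g 0 = 0" and prim_zero [simp]: "prim (\<lambda>_. 0) t = 0"
  by (simp_all add: prim_def)

lemma continuous_on_prim: "g integrable_on {0..l} \<Longrightarrow> continuous_on {0..l} (prim g)"
  unfolding prim_def[abs_def] by (rule indefinite_integral_continuous_1)

lemma set_lebesgue_integral_eq_prim:
  assumes "sqint l g" "t \<in> {0..l}"
  shows "(LINT s:{0..t}|lborel. g s) = prim g t"
  unfolding prim_def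
  by (rule set_borel_integral_eq_integral(2))
    (rule set_integrable_subset[OF sqint_imp_set_integrable[OF assms(1)]], use assms in auto)

lemma cmod_prim_le:
  assumes "continuous_on {0..l} f" "\<And>s. s \<in> {0..l} \<Longrightarrow> cmod (f s) \<le> B" "t \<in> {0..l}"
  shows "cmod (prim f t) \<le> l * B"
proof -
  have "B \<ge> 0" using assms(2)[OF assms(3)] norm_ge_zero order_trans by blast
  have "cmod (prim f t) \<le> B * (t - 0)"
    unfolding prim_def by (rule integral_bound) (use assms in \<open>auto intro: continuous_on_subset\<close>)
  also have "\<dots> \<le> B * l" using assms(3) \<open>B \<ge> 0\<close> by (intro mult_left_mono) auto
  finally show ?thesis by (simp add: mult.commute)
qed

lemma cmod_prim_power2_le:
  assumes g: "sqint l g" and t: "t \<in> {0..l}"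
  shows "(cmod (prim g t))\<^sup>2 \<le> l * edge_norm2 l g"
proof -
  interpret finite_measure "edge_measure l" by (rule finite_measure_edge)
  have l: "0 \<le> l" using t by auto
  have i: "set_integrable lborel {0..l} g" by (rule sqint_imp_set_integrable[OF g])
  have i': "set_integrable lborel {0..t} g" by (rule set_integrable_subset[OF i]) (use t in auto)
  have "cmod (prim g t) \<le> (LINT s:{0..t}|lborel. cmod (g s))"
    unfolding set_lebesgue_integral_eq_prim[OF g t, symmetric]
    by (rule set_integral_norm_bound[OF i'])
  also have "\<dots> \<le> (LINT s:{0..l}|lborel. cmod (g s))"
    unfolding set_lebesgue_integral_def
    by (rule integral_mono)
      (use set_integrable_norm[OF i] set_integrable_norm[OF i'] t in
        \<open>auto simp: set_integrable_def indicator_def\<close>)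
  also have "\<dots> = (\<integral>s. cmod (g s) \<partial>edge_measure l)"
    by (simp add: set_lebesgue_integral_def integral_restrict_space)
  finally have "(cmod (prim g t))\<^sup>2 \<le> (\<integral>s. cmod (g s) \<partial>edge_measure l)\<^sup>2"
    by (intro power_mono) auto
  also have "\<dots> \<le> l * edge_norm2 l g"
    using power2_integral_le[of "\<lambda>s. cmod (g s)"] g
    by (auto simp: sqint_iff edge_norm2_eq measure_edge[OF l]
        intro: measurable_compose[OF _ borel_measurable_norm])
  finally show ?thesis .
qed

lemma has_vector_derivative_iff_eq_prim:
  assumes "continuous_on {0..l} f"
  shows "(\<forall>t\<in>{0..l}. (F has_vector_derivative f t) (at t within {0..l})) \<longleftrightarrow>
    (\<forall>t\<in>{0..l}. F t = F 0 + prim f t)" (is "?deriv \<longleftrightarrow> ?eq")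
proof
  assume ?deriv
  show ?eq
  proof
    fix t assume t: "t \<in> {0..l}"
    have "(f has_integral F t - F 0) {0..t}"
      by (rule fundamental_theorem_of_calculus)
        (use t in \<open>auto intro!: has_vector_derivative_within_subset[OF bspec[OF \<open>?deriv\<close>]]\<close>)
    then show "F t = F 0 + prim f t" by (simp add: prim_def integral_unique)
  qed
next
  assume eq: ?eq
  show ?deriv
  proof
    fix t assume t: "t \<in> {0..l}"
    have "((\<lambda>s. F 0 + prim f s) has_vector_derivative 0 + f t) (at t within {0..l})"
      unfolding prim_def[abs_def]
      by (intro has_vector_derivative_add has_vector_derivative_const
          integral_has_vector_derivative assms t)
    then have "((\<lambda>s. F 0 + prim f s) has_vector_derivative f t) (at t within {0..l})" by simp
    then show "(F has_vector_derivative f t) (at t within {0..l})"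
      by (rule has_vector_derivative_transform[OF t, rotated]) (rule eq[rule_format])
  qed
qed

lemma prim_has_vector_derivative:
  "continuous_on {0..l} f \<Longrightarrow> t \<in> {0..l} \<Longrightarrow> (prim f has_vector_derivative f t) (at t within {0..l})"
  using has_vector_derivative_iff_eq_prim[of l f "prim f"] by simp

lemma continuous_on_if_has_vector_derivative:
  "(\<And>t. t \<in> S \<Longrightarrow> (u has_vector_derivative u' t) (at t within S)) \<Longrightarrow> continuous_on S u"
  by (meson continuous_on_eq_continuous_within has_vector_derivative_continuous)

section \<open>The Helmholtz equation on an edge\<close>

definition cs :: "complex \<Rightarrow> real \<Rightarrow> complex" where
  "cs \<kappa> t = cos (\<kappa> * of_real t)"

definition sn :: "complex \<Rightarrow> real \<Rightarrow> complex" where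
  "sn \<kappa> t = sin (\<kappa> * of_real t) / \<kappa>"

lemma cs_0 [simp]: "cs \<kappa> 0 = 1" and sn_0 [simp]: "sn \<kappa> 0 = 0"
  by (simp_all add: cs_def sn_def)

lemma cs_has_vector_derivative:
  assumes "\<kappa> \<noteq> 0"
  shows "(cs \<kappa> has_vector_derivative - \<kappa>\<^sup>2 * sn \<kappa> t) (at t within S)"
proof -
  have "((\<lambda>z. cos (\<kappa> * z)) has_field_derivative - sin (\<kappa> * of_real t) * \<kappa>) (at (of_real t))"
    by (auto intro!: derivative_eq_intros)
  from has_vector_derivative_real_field[OF this, of S] show ?thesis
    using assms by (simp add: cs_def[abs_def] sn_def power2_eq_square mult.commute)
qed

lemma sn_has_vector_derivative:
  assumes "\<kappa> \<noteq> 0"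
  shows "(sn \<kappa> has_vector_derivative cs \<kappa> t) (at t within S)"
proof -
  have "((\<lambda>z. sin (\<kappa> * z) / \<kappa>) has_field_derivative cos (\<kappa> * of_real t)) (at (of_real t))"
    using assms by (auto intro!: derivative_eq_intros)
  from has_vector_derivative_real_field[OF this, of S] show ?thesis
    by (simp add: cs_def sn_def[abs_def])
qed

lemma continuous_on_cs: "continuous_on S (cs \<kappa>)" and continuous_on_sn: "continuous_on S (sn \<kappa>)"
  unfolding cs_def[abs_def] sn_def[abs_def] divide_inverse by (intro continuous_intros)+

lemma cs_sn_pythagoras: "\<kappa> \<noteq> 0 \<Longrightarrow> (cs \<kappa> t)\<^sup>2 + \<kappa>\<^sup>2 * (sn \<kappa> t)\<^sup>2 = 1"
  by (simp add: cs_def sn_def power_divide)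

lemma cs_half: "\<kappa> \<noteq> 0 \<Longrightarrow> cs \<kappa> t = (cs \<kappa> (t/2))\<^sup>2 - \<kappa>\<^sup>2 * (sn \<kappa> (t/2))\<^sup>2"
  using cos_double[of "\<kappa> * of_real (t/2)"] by (simp add: cs_def sn_def power_divide)

lemma sn_half: "sn \<kappa> t = 2 * cs \<kappa> (t/2) * sn \<kappa> (t/2)"
  using sin_double[of "\<kappa> * of_real (t/2)"] by (simp add: cs_def sn_def)

lemma cs_sn_bounded:
  obtains M where "\<And>t. t \<in> {0..l} \<Longrightarrow> cmod (cs \<kappa> t) \<le> M" "\<And>t. t \<in> {0..l} \<Longrightarrow> cmod (sn \<kappa> t) \<le> M"
proof -
  have "bounded (cs \<kappa> ` {0..l} \<union> sn \<kappa> ` {0..l})"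
    by (intro bounded_Un[THEN iffD2] conjI compact_imp_bounded compact_continuous_image
        continuous_on_cs continuous_on_sn compact_Icc)
  then show thesis unfolding bounded_iff using that by blast
qed

text \<open>For square-integrable \<open>g\<close> the derivative of a solution of \<open>- u'' = g + \<kappa>\<^sup>2 u\<close> is only absolutely
  continuous, but the quasi-derivative \<open>u' + \<integral>g\<close> is continuously differentiable.\<close>

definition helmholtz ::
  "complex \<Rightarrow> real \<Rightarrow> (real \<Rightarrow> complex) \<Rightarrow> (real \<Rightarrow> complex) \<Rightarrow> (real \<Rightarrow> complex) \<Rightarrow> bool" where
  "helmholtz \<kappa> l g u u' \<longleftrightarrow>
     (\<forall>t\<in>{0..l}. (u has_vector_derivative u' t) (at t within {0..l})) \<and>
     (\<forall>t\<in>{0..l}. ((\<lambda>s. u' s + prim g s) has_vector_derivative - \<kappa>\<^sup>2 * u t) (at t within {0..l}))"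

lemma helmholtz_continuous_on: "helmholtz \<kappa> l g u u' \<Longrightarrow> continuous_on {0..l} u"
  unfolding helmholtz_def by (blast intro: continuous_on_if_has_vector_derivative)

lemma helmholtz_dv:
  assumes "helmholtz \<kappa> l g u u'" "t \<in> {0..l}" "l > 0"
  shows "dv l u t = u' t"
  unfolding dv_def
  by (rule vector_derivative_within_closed_interval) (use assms in \<open>auto simp: helmholtz_def\<close>)

lemma H2sol_iff_helmholtz:
  assumes g: "sqint l g"
  shows "H2sol l u (\<lambda>t. - (g t + \<kappa>\<^sup>2 * u t)) \<longleftrightarrow> (\<exists>u'. helmholtz \<kappa> l g u u')"
proof (cases "continuous_on {0..l} u")
  case True
  define w where "w = (\<lambda>t. - (g t + \<kappa>\<^sup>2 * u t))"
  have u: "sqint l u" by (rule sqint_if_continuous_on[OF True])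
  have w: "sqint l w"
    using sqint_add[OF sqint_cmult[OF g, of "-1"] sqint_cmult[OF u, of "- \<kappa>\<^sup>2"]] by (simp add: w_def)
  have prim_w: "prim w t = prim (\<lambda>t. - \<kappa>\<^sup>2 * u t) t - prim g t" if "t \<in> {0..l}" for t
  proof -
    have "(\<lambda>s. - \<kappa>\<^sup>2 * u s) integrable_on {0..t}" "g integrable_on {0..t}"
      using integrable_on_subinterval[OF sqint_imp_integrable_on[OF sqint_cmult[OF u]], of 0 t "- \<kappa>\<^sup>2"]
        integrable_on_subinterval[OF sqint_imp_integrable_on[OF g], of 0 t] that by auto
    moreover have "w = (\<lambda>t. - \<kappa>\<^sup>2 * u t - g t)" by (simp add: w_def fun_eq_iff)
    ultimately show ?thesis unfolding prim_def by (simp only: integral_diff)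
  qed
  have "continuous_on {0..l} (\<lambda>t. - \<kappa>\<^sup>2 * u t)" by (intro continuous_intros True)
  from has_vector_derivative_iff_eq_prim[OF this]
  have "(\<forall>t\<in>{0..l}. ((\<lambda>s. u' s + prim g s) has_vector_derivative - \<kappa>\<^sup>2 * u t) (at t within {0..l}))
      \<longleftrightarrow> (\<forall>t\<in>{0..l}. u' t = u' 0 + prim w t)" for u'
    by (auto simp: prim_w add_diff_eq eq_diff_eq)
  moreover have "(\<forall>t\<in>{0..l}. u' t = u' 0 + prim w t)
      \<longleftrightarrow> (\<forall>t\<in>{0..l}. u' t = u' 0 + (LINT s:{0..t}|lborel. w s))" for u'
    using set_lebesgue_integral_eq_prim[OF w] by simp
  ultimately show ?thesis unfolding H2sol_def helmholtz_def w_def[symmetric] by (simp only: w simp_thms)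
next
  case False
  then have "(\<forall>t\<in>{0..l}. (u has_vector_derivative u' t) (at t within {0..l})) \<longleftrightarrow> False" for u'
    using continuous_on_if_has_vector_derivative[of "{0..l}" u u'] by blast
  then show ?thesis unfolding H2sol_def helmholtz_def by (simp only: simp_thms)
qed

lemma helmholtz_diff:
  assumes "helmholtz \<kappa> l g u u'" "helmholtz \<kappa> l g v v'"
  shows "helmholtz \<kappa> l (\<lambda>_. 0) (\<lambda>t. u t - v t) (\<lambda>t. u' t - v' t)"
  unfolding helmholtz_def
proof (intro conjI ballI)
  fix t assume t: "t \<in> {0..l}"
  show "((\<lambda>t. u t - v t) has_vector_derivative u' t - v' t) (at t within {0..l})"
    using assms t unfolding helmholtz_def by (intro has_vector_derivative_diff) auto
  have "((\<lambda>s. (u' s + prim g s) - (v' s + prim g s)) has_vector_derivative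
      - \<kappa>\<^sup>2 * u t - - \<kappa>\<^sup>2 * v t) (at t within {0..l})"
    using assms t unfolding helmholtz_def by (intro has_vector_derivative_diff) auto
  then show "((\<lambda>s. u' s - v' s + prim (\<lambda>_. 0) s) has_vector_derivative - \<kappa>\<^sup>2 * (u t - v t))
      (at t within {0..l})"
    by (simp add: algebra_simps)
qed

lemma helmholtz_zero_data:
  assumes \<kappa>: "\<kappa> \<noteq> 0" and h: "helmholtz \<kappa> l (\<lambda>_. 0) u u'" and zero: "u 0 = 0" "u' 0 = 0"
    and t: "t \<in> {0..l}"
  shows "u t = 0" and "u' t = 0"
proof -
  have u: "(u has_vector_derivative u' s) (at s within {0..l})"
    and u': "(u' has_vector_derivative - \<kappa>\<^sup>2 * u s) (at s within {0..l})" if "s \<in> {0..l}" for s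
    using h that by (auto simp: helmholtz_def)
  note cs = cs_has_vector_derivative[OF \<kappa>] and sn = sn_has_vector_derivative[OF \<kappa>]
  have const: "D t = D 0"
    if "\<And>s. s \<in> {0..l} \<Longrightarrow> (D has_vector_derivative 0) (at s within {0..l})" for D :: "real \<Rightarrow> complex"
  proof -
    have "\<forall>t\<in>{0..l}. D t = D 0 + prim (\<lambda>_. 0) t"
      by (rule has_vector_derivative_iff_eq_prim[THEN iffD1]) (auto intro: that)
    from bspec[OF this t] show ?thesis by simp
  qed
  have cos_part: "u t * cs \<kappa> t - u' t * sn \<kappa> t = 0"
  proof (subst const[of "\<lambda>s. u s * cs \<kappa> s - u' s * sn \<kappa> s"])
    fix s assume s: "s \<in> {0..l}"
    have "((\<lambda>s. u s * cs \<kappa> s - u' s * sn \<kappa> s) has_vector_derivative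
      (u s * (- \<kappa>\<^sup>2 * sn \<kappa> s) + u' s * cs \<kappa> s) - (u' s * cs \<kappa> s + - \<kappa>\<^sup>2 * u s * sn \<kappa> s))
      (at s within {0..l})"
      by (intro has_vector_derivative_diff has_vector_derivative_mult u u' cs sn s)
    then show "((\<lambda>s. u s * cs \<kappa> s - u' s * sn \<kappa> s) has_vector_derivative 0) (at s within {0..l})"
      by (simp add: algebra_simps)
  qed (simp add: zero)
  have sin_part: "u' t * cs \<kappa> t + \<kappa>\<^sup>2 * (u t * sn \<kappa> t) = 0"
  proof (subst const[of "\<lambda>s. u' s * cs \<kappa> s + \<kappa>\<^sup>2 * (u s * sn \<kappa> s)"])
    fix s assume s: "s \<in> {0..l}"
    have "((\<lambda>s. u' s * cs \<kappa> s + \<kappa>\<^sup>2 * (u s * sn \<kappa> s)) has_vector_derivative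
      (u' s * (- \<kappa>\<^sup>2 * sn \<kappa> s) + - \<kappa>\<^sup>2 * u s * cs \<kappa> s) + \<kappa>\<^sup>2 * (u s * cs \<kappa> s + u' s * sn \<kappa> s))
      (at s within {0..l})"
      by (intro has_vector_derivative_add has_vector_derivative_mult has_vector_derivative_mult_right
          u u' cs sn s)
    then show "((\<lambda>s. u' s * cs \<kappa> s + \<kappa>\<^sup>2 * (u s * sn \<kappa> s)) has_vector_derivative 0)
      (at s within {0..l})"
      by (simp add: algebra_simps)
  qed (simp add: zero)
  have "u t * ((cs \<kappa> t)\<^sup>2 + \<kappa>\<^sup>2 * (sn \<kappa> t)\<^sup>2) = 0" "u' t * ((cs \<kappa> t)\<^sup>2 + \<kappa>\<^sup>2 * (sn \<kappa> t)\<^sup>2) = 0"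
    using cos_part sin_part by algebra+
  then show "u t = 0" "u' t = 0" by (simp_all add: cs_sn_pythagoras[OF \<kappa>])
qed

text \<open>Variation of constants for the first-order system \<open>u' = w - \<integral>g\<close>, \<open>w' = - \<kappa>\<^sup>2 u\<close>.\<close>

definition cos_coeff :: "complex \<Rightarrow> (real \<Rightarrow> complex) \<Rightarrow> complex \<Rightarrow> real \<Rightarrow> complex" where
  "cos_coeff \<kappa> g \<alpha> t = \<alpha> - prim (\<lambda>s. cs \<kappa> s * prim g s) t"

definition sin_coeff :: "complex \<Rightarrow> (real \<Rightarrow> complex) \<Rightarrow> complex \<Rightarrow> real \<Rightarrow> complex" where
  "sin_coeff \<kappa> g \<beta> t = \<beta> - \<kappa>\<^sup>2 * prim (\<lambda>s. sn \<kappa> s * prim g s) t"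

definition edge_sol :: "complex \<Rightarrow> (real \<Rightarrow> complex) \<Rightarrow> complex \<Rightarrow> complex \<Rightarrow> real \<Rightarrow> complex" where
  "edge_sol \<kappa> g \<alpha> \<beta> t = cos_coeff \<kappa> g \<alpha> t * cs \<kappa> t + sin_coeff \<kappa> g \<beta> t * sn \<kappa> t"

definition edge_sol' :: "complex \<Rightarrow> (real \<Rightarrow> complex) \<Rightarrow> complex \<Rightarrow> complex \<Rightarrow> real \<Rightarrow> complex" where
  "edge_sol' \<kappa> g \<alpha> \<beta> t = sin_coeff \<kappa> g \<beta> t * cs \<kappa> t - \<kappa>\<^sup>2 * (cos_coeff \<kappa> g \<alpha> t * sn \<kappa> t) - prim g t"

lemma edge_sol_0 [simp]: "edge_sol \<kappa> g \<alpha> \<beta> 0 = \<alpha>" and edge_sol'_0 [simp]: "edge_sol' \<kappa> g \<alpha> \<beta> 0 = \<beta>"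
  by (simp_all add: edge_sol_def edge_sol'_def cos_coeff_def sin_coeff_def)

lemma edge_sol_split:
  "edge_sol \<kappa> g \<alpha> \<beta> t = edge_sol \<kappa> g 0 0 t + \<alpha> * cs \<kappa> t + \<beta> * sn \<kappa> t"
  "edge_sol' \<kappa> g \<alpha> \<beta> t = edge_sol' \<kappa> g 0 0 t + \<beta> * cs \<kappa> t - \<kappa>\<^sup>2 * \<alpha> * sn \<kappa> t"
  by (simp_all add: edge_sol_def edge_sol'_def cos_coeff_def sin_coeff_def algebra_simps)

lemma edge_sol_homogeneous:
  "edge_sol \<kappa> (\<lambda>_. 0) \<alpha> \<beta> t = \<alpha> * cs \<kappa> t + \<beta> * sn \<kappa> t"
  "edge_sol' \<kappa> (\<lambda>_. 0) \<alpha> \<beta> t = \<beta> * cs \<kappa> t - \<kappa>\<^sup>2 * \<alpha> * sn \<kappa> t"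
  by (simp_all add: edge_sol_def edge_sol'_def cos_coeff_def sin_coeff_def)

lemma
  assumes g: "sqint l g" and t: "t \<in> {0..l}"
  shows cos_coeff_has_vector_derivative:
      "(cos_coeff \<kappa> g \<alpha> has_vector_derivative - (cs \<kappa> t * prim g t)) (at t within {0..l})"
    and sin_coeff_has_vector_derivative:
      "(sin_coeff \<kappa> g \<beta> has_vector_derivative - (\<kappa>\<^sup>2 * (sn \<kappa> t * prim g t))) (at t within {0..l})"
proof -
  have G: "continuous_on {0..l} (prim g)" by (rule continuous_on_prim[OF sqint_imp_integrable_on[OF g]])
  have "(cos_coeff \<kappa> g \<alpha> has_vector_derivative 0 - cs \<kappa> t * prim g t) (at t within {0..l})"
    unfolding cos_coeff_def[abs_def]
    by (intro has_vector_derivative_diff has_vector_derivative_const prim_has_vector_derivative[OF _ t]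
        continuous_intros continuous_on_cs G)
  then show "(cos_coeff \<kappa> g \<alpha> has_vector_derivative - (cs \<kappa> t * prim g t)) (at t within {0..l})" by simp
  have "(sin_coeff \<kappa> g \<beta> has_vector_derivative 0 - \<kappa>\<^sup>2 * (sn \<kappa> t * prim g t)) (at t within {0..l})"
    unfolding sin_coeff_def[abs_def]
    by (intro has_vector_derivative_diff has_vector_derivative_const has_vector_derivative_mult_right
        prim_has_vector_derivative[OF _ t] continuous_intros continuous_on_sn G)
  then show "(sin_coeff \<kappa> g \<beta> has_vector_derivative - (\<kappa>\<^sup>2 * (sn \<kappa> t * prim g t))) (at t within {0..l})"
    by simp
qed

lemma helmholtz_edge_sol:
  assumes \<kappa>: "\<kappa> \<noteq> 0" and g: "sqint l g"
  shows "helmholtz \<kappa> l g (edge_sol \<kappa> g \<alpha> \<beta>) (edge_sol' \<kappa> g \<alpha> \<beta>)"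
  unfolding helmholtz_def
proof (intro conjI ballI)
  fix t assume t: "t \<in> {0..l}"
  note A = cos_coeff_has_vector_derivative[OF g t] and B = sin_coeff_has_vector_derivative[OF g t]
  note cs = cs_has_vector_derivative[OF \<kappa>] and sn = sn_has_vector_derivative[OF \<kappa>]
  let ?A = "cos_coeff \<kappa> g \<alpha> t" and ?B = "sin_coeff \<kappa> g \<beta> t"
  have "(edge_sol \<kappa> g \<alpha> \<beta> has_vector_derivative
      (?A * (- \<kappa>\<^sup>2 * sn \<kappa> t) + - (cs \<kappa> t * prim g t) * cs \<kappa> t)
      + (?B * cs \<kappa> t + - (\<kappa>\<^sup>2 * (sn \<kappa> t * prim g t)) * sn \<kappa> t)) (at t within {0..l})"
    unfolding edge_sol_def[abs_def]
    by (intro has_vector_derivative_add has_vector_derivative_mult A B cs sn)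
  also have "(?A * (- \<kappa>\<^sup>2 * sn \<kappa> t) + - (cs \<kappa> t * prim g t) * cs \<kappa> t)
      + (?B * cs \<kappa> t + - (\<kappa>\<^sup>2 * (sn \<kappa> t * prim g t)) * sn \<kappa> t)
    = ?B * cs \<kappa> t - \<kappa>\<^sup>2 * (?A * sn \<kappa> t) - ((cs \<kappa> t)\<^sup>2 + \<kappa>\<^sup>2 * (sn \<kappa> t)\<^sup>2) * prim g t"
    by (simp add: power2_eq_square algebra_simps)
  finally show "(edge_sol \<kappa> g \<alpha> \<beta> has_vector_derivative edge_sol' \<kappa> g \<alpha> \<beta> t) (at t within {0..l})"
    by (simp add: edge_sol'_def cs_sn_pythagoras[OF \<kappa>])
  have "((\<lambda>s. sin_coeff \<kappa> g \<beta> s * cs \<kappa> s - \<kappa>\<^sup>2 * (cos_coeff \<kappa> g \<alpha> s * sn \<kappa> s)) has_vector_derivative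
      (?B * (- \<kappa>\<^sup>2 * sn \<kappa> t) + - (\<kappa>\<^sup>2 * (sn \<kappa> t * prim g t)) * cs \<kappa> t)
      - \<kappa>\<^sup>2 * (?A * cs \<kappa> t + - (cs \<kappa> t * prim g t) * sn \<kappa> t)) (at t within {0..l})"
    by (intro has_vector_derivative_diff has_vector_derivative_mult has_vector_derivative_mult_right
        A B cs sn)
  also have "(?B * (- \<kappa>\<^sup>2 * sn \<kappa> t) + - (\<kappa>\<^sup>2 * (sn \<kappa> t * prim g t)) * cs \<kappa> t)
      - \<kappa>\<^sup>2 * (?A * cs \<kappa> t + - (cs \<kappa> t * prim g t) * sn \<kappa> t) = - \<kappa>\<^sup>2 * edge_sol \<kappa> g \<alpha> \<beta> t"
    by (simp add: edge_sol_def algebra_simps)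
  finally show "((\<lambda>s. edge_sol' \<kappa> g \<alpha> \<beta> s + prim g s) has_vector_derivative - \<kappa>\<^sup>2 * edge_sol \<kappa> g \<alpha> \<beta> t)
      (at t within {0..l})"
    by (simp add: edge_sol'_def)
qed

lemma helmholtz_eq_edge_sol:
  assumes \<kappa>: "\<kappa> \<noteq> 0" and g: "sqint l g" and u: "helmholtz \<kappa> l g u u'" and t: "t \<in> {0..l}"
  shows "u t = edge_sol \<kappa> g (u 0) (u' 0) t" and "u' t = edge_sol' \<kappa> g (u 0) (u' 0) t"
  using helmholtz_zero_data[OF \<kappa> helmholtz_diff[OF u helmholtz_edge_sol[OF \<kappa> g]] _ _ t, of "u 0" "u' 0"]
  by simp_all

lemma sqint_edge_sol: "\<kappa> \<noteq> 0 \<Longrightarrow> sqint l g \<Longrightarrow> sqint l (edge_sol \<kappa> g \<alpha> \<beta>)"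
  by (rule sqint_if_continuous_on[OF helmholtz_continuous_on[OF helmholtz_edge_sol]])

lemma cmod_prim_mult_prim_le:
  assumes g: "sqint l g" and t: "t \<in> {0..l}"
    and f: "continuous_on {0..l} f" "\<And>s. s \<in> {0..l} \<Longrightarrow> cmod (f s) \<le> M"
  shows "cmod (prim (\<lambda>s. f s * prim g s) t) \<le> l * M * sqrt (l * edge_norm2 l g)"
proof -
  have "M \<ge> 0" using f(2)[OF t] by (rule order_trans[OF norm_ge_zero])
  have "cmod (prim (\<lambda>s. f s * prim g s) t) \<le> l * (M * sqrt (l * edge_norm2 l g))"
  proof (rule cmod_prim_le[OF _ _ t])
    show "continuous_on {0..l} (\<lambda>s. f s * prim g s)"
      by (intro continuous_intros f(1) continuous_on_prim sqint_imp_integrable_on g)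
    fix s assume s: "s \<in> {0..l}"
    show "cmod (f s * prim g s) \<le> M * sqrt (l * edge_norm2 l g)"
      unfolding norm_mult
      by (intro mult_mono f(2)[OF s] real_le_rsqrt[OF cmod_prim_power2_le[OF g s]] \<open>M \<ge> 0\<close> norm_ge_zero)
  qed
  then show ?thesis by (simp add: mult.assoc)
qed

definition data_norm2 :: "real \<Rightarrow> (real \<Rightarrow> complex) \<Rightarrow> complex \<Rightarrow> complex \<Rightarrow> real" where
  "data_norm2 l g \<alpha> \<beta> = edge_norm2 l g + (cmod \<alpha>)\<^sup>2 + (cmod \<beta>)\<^sup>2"

lemma data_norm2_nonneg: "0 \<le> data_norm2 l g \<alpha> \<beta>"
  by (simp add: data_norm2_def edge_norm2_nonneg)

lemma le_sqrt_data_norm2: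
  shows "cmod \<alpha> \<le> sqrt (data_norm2 l g \<alpha> \<beta>)" and "cmod \<beta> \<le> sqrt (data_norm2 l g \<alpha> \<beta>)"
    and "0 \<le> l \<Longrightarrow> sqrt (l * edge_norm2 l g) \<le> sqrt l * sqrt (data_norm2 l g \<alpha> \<beta>)"
  using edge_norm2_nonneg[of l g]
  by (auto simp: data_norm2_def real_sqrt_mult intro!: real_le_rsqrt mult_left_mono)

lemma coeff_bound:
  obtains K where
    "\<And>g \<alpha> \<beta> t. sqint l g \<Longrightarrow> t \<in> {0..l} \<Longrightarrow> cmod (cos_coeff \<kappa> g \<alpha> t) \<le> K * sqrt (data_norm2 l g \<alpha> \<beta>)"
    "\<And>g \<alpha> \<beta> t. sqint l g \<Longrightarrow> t \<in> {0..l} \<Longrightarrow> cmod (sin_coeff \<kappa> g \<beta> t) \<le> K * sqrt (data_norm2 l g \<alpha> \<beta>)"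
proof -
  obtain M where M: "\<And>t. t \<in> {0..l} \<Longrightarrow> cmod (cs \<kappa> t) \<le> M" "\<And>t. t \<in> {0..l} \<Longrightarrow> cmod (sn \<kappa> t) \<le> M"
    by (rule cs_sn_bounded[where \<kappa> = \<kappa> and l = l]) (rule that)
  define c where "c = l * M * sqrt l"
  show thesis
  proof
    fix g \<alpha> \<beta> t assume g: "sqint l g" and t: "t \<in> {0..l}"
    define N where "N = sqrt (data_norm2 l g \<alpha> \<beta>)"
    have l: "0 \<le> l" and M0: "0 \<le> M" using order_trans[OF norm_ge_zero M(1)[OF t]] t by simp_all
    have cN: "0 \<le> c * N" "0 \<le> (cmod \<kappa>)\<^sup>2 * (c * N)"
      using l M0 by (simp_all add: c_def N_def data_norm2_nonneg)
    have "cmod (prim (\<lambda>s. f s * prim g s) t) \<le> c * N"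
      if "continuous_on {0..l} f" "\<And>s. s \<in> {0..l} \<Longrightarrow> cmod (f s) \<le> M" for f
    proof -
      have "cmod (prim (\<lambda>s. f s * prim g s) t) \<le> l * M * sqrt (l * edge_norm2 l g)"
        by (rule cmod_prim_mult_prim_le[OF g t that])
      also have "\<dots> \<le> l * M * (sqrt l * N)"
        unfolding N_def using l M0 by (intro mult_left_mono le_sqrt_data_norm2(3)) auto
      finally show ?thesis by (simp add: c_def mult.assoc)
    qed
    note prim_cs = this[OF continuous_on_cs M(1)] and prim_sn = this[OF continuous_on_sn M(2)]
    have "cmod (cos_coeff \<kappa> g \<alpha> t) \<le> N + c * N"
      unfolding cos_coeff_def N_def
      by (rule order_trans[OF norm_triangle_ineq4
            add_mono[OF le_sqrt_data_norm2(1) prim_cs[unfolded N_def]]])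
    then show "cmod (cos_coeff \<kappa> g \<alpha> t) \<le> (1 + c + (cmod \<kappa>)\<^sup>2 * c) * sqrt (data_norm2 l g \<alpha> \<beta>)"
      unfolding N_def[symmetric] using cN by (simp add: algebra_simps)
    have "cmod (\<kappa>\<^sup>2 * prim (\<lambda>s. sn \<kappa> s * prim g s) t) \<le> (cmod \<kappa>)\<^sup>2 * (c * N)"
      unfolding norm_mult norm_power by (rule mult_left_mono[OF prim_sn]) simp_all
    then have "cmod (sin_coeff \<kappa> g \<beta> t) \<le> N + (cmod \<kappa>)\<^sup>2 * (c * N)"
      unfolding sin_coeff_def N_def
      by (rule order_trans[OF norm_triangle_ineq4 add_mono[OF le_sqrt_data_norm2(2)]])
    then show "cmod (sin_coeff \<kappa> g \<beta> t) \<le> (1 + c + (cmod \<kappa>)\<^sup>2 * c) * sqrt (data_norm2 l g \<alpha> \<beta>)"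
      unfolding N_def[symmetric] using cN by (simp add: algebra_simps)
  qed
qed

lemma edge_sol_bound:
  obtains K where "K \<ge> 0"
    "\<And>g \<alpha> \<beta> t. sqint l g \<Longrightarrow> t \<in> {0..l} \<Longrightarrow> (cmod (edge_sol \<kappa> g \<alpha> \<beta> t))\<^sup>2 \<le> K * data_norm2 l g \<alpha> \<beta>"
    "\<And>g \<alpha> \<beta> t. sqint l g \<Longrightarrow> t \<in> {0..l} \<Longrightarrow> (cmod (edge_sol' \<kappa> g \<alpha> \<beta> t))\<^sup>2 \<le> K * data_norm2 l g \<alpha> \<beta>"
proof -
  obtain M where M: "\<And>t. t \<in> {0..l} \<Longrightarrow> cmod (cs \<kappa> t) \<le> M" "\<And>t. t \<in> {0..l} \<Longrightarrow> cmod (sn \<kappa> t) \<le> M"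
    by (rule cs_sn_bounded[where \<kappa> = \<kappa> and l = l]) (rule that)
  obtain c where c:
    "\<And>g \<alpha> \<beta> t. sqint l g \<Longrightarrow> t \<in> {0..l} \<Longrightarrow> cmod (cos_coeff \<kappa> g \<alpha> t) \<le> c * sqrt (data_norm2 l g \<alpha> \<beta>)"
    "\<And>g \<alpha> \<beta> t. sqint l g \<Longrightarrow> t \<in> {0..l} \<Longrightarrow> cmod (sin_coeff \<kappa> g \<beta> t) \<le> c * sqrt (data_norm2 l g \<alpha> \<beta>)"
    by (rule coeff_bound[where \<kappa> = \<kappa> and l = l]) (rule that)
  define k where "k = c * M"
  define L where "L = 2 * k + (cmod \<kappa>)\<^sup>2 * k + sqrt l"
  have linear: "cmod (edge_sol \<kappa> g \<alpha> \<beta> t) \<le> L * sqrt (data_norm2 l g \<alpha> \<beta>)"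
    "cmod (edge_sol' \<kappa> g \<alpha> \<beta> t) \<le> L * sqrt (data_norm2 l g \<alpha> \<beta>)"
    if g: "sqint l g" and t: "t \<in> {0..l}" for g \<alpha> \<beta> t
  proof -
    define N where "N = sqrt (data_norm2 l g \<alpha> \<beta>)"
    note A = c(1)[OF g t, of \<alpha> \<beta>, folded N_def] and B = c(2)[OF g t, of \<beta> \<alpha>, folded N_def]
    have prod_le: "cmod (x * f) \<le> k * N" if "cmod x \<le> c * N" "cmod f \<le> M" for x f
      using mult_mono[OF that order_trans[OF norm_ge_zero that(1)] norm_ge_zero]
      by (simp add: norm_mult k_def mult_ac)
    have G: "cmod (prim g t) \<le> sqrt l * N"
      using order_trans[OF real_le_rsqrt[OF cmod_prim_power2_le[OF g t]] le_sqrt_data_norm2(3)] t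
      by (simp add: N_def)
    have kN: "0 \<le> k * N" by (rule order_trans[OF norm_ge_zero prod_le[OF A M(1)[OF t]]])
    have nonneg: "0 \<le> (cmod \<kappa>)\<^sup>2 * (k * N)" "0 \<le> sqrt l * N"
      using kN t by (simp_all add: N_def data_norm2_nonneg)
    have "cmod (edge_sol \<kappa> g \<alpha> \<beta> t) \<le> k * N + k * N"
      unfolding edge_sol_def by (intro norm_triangle_mono prod_le A B M t)
    then show "cmod (edge_sol \<kappa> g \<alpha> \<beta> t) \<le> L * sqrt (data_norm2 l g \<alpha> \<beta>)"
      using nonneg unfolding N_def[symmetric] L_def by (simp add: algebra_simps)
    have "cmod (\<kappa>\<^sup>2 * (cos_coeff \<kappa> g \<alpha> t * sn \<kappa> t)) \<le> (cmod \<kappa>)\<^sup>2 * (k * N)"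
      unfolding norm_mult[of "\<kappa>\<^sup>2"] norm_power
      by (rule mult_left_mono[OF prod_le[OF A M(2)[OF t]]]) simp
    then have "cmod (edge_sol' \<kappa> g \<alpha> \<beta> t) \<le> (k * N + (cmod \<kappa>)\<^sup>2 * (k * N)) + sqrt l * N"
      unfolding edge_sol'_def by (intro norm_triangle_le_diff add_mono prod_le[OF B M(1)[OF t]] G)
    then show "cmod (edge_sol' \<kappa> g \<alpha> \<beta> t) \<le> L * sqrt (data_norm2 l g \<alpha> \<beta>)"
      using kN unfolding N_def[symmetric] L_def by (simp add: algebra_simps)
  qed
  have square: "(cmod x)\<^sup>2 \<le> L\<^sup>2 * data_norm2 l g \<alpha> \<beta>"
    if "cmod x \<le> L * sqrt (data_norm2 l g \<alpha> \<beta>)" for x g \<alpha> \<beta>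
    using power_mono[OF that norm_ge_zero, of 2] by (simp add: power_mult_distrib data_norm2_nonneg)
  show thesis by (rule that[of "L\<^sup>2"]) (simp_all add: square linear)
qed

lemma edge_norm2_edge_sol_le:
  assumes "\<kappa> \<noteq> 0" "0 \<le> l"
  obtains K where "K \<ge> 0"
    "\<And>g \<alpha> \<beta>. sqint l g \<Longrightarrow> edge_norm2 l (edge_sol \<kappa> g \<alpha> \<beta>) \<le> K * data_norm2 l g \<alpha> \<beta>"
proof -
  obtain K where K: "K \<ge> 0" "\<And>g \<alpha> \<beta> t. sqint l g \<Longrightarrow> t \<in> {0..l} \<Longrightarrow>
      (cmod (edge_sol \<kappa> g \<alpha> \<beta> t))\<^sup>2 \<le> K * data_norm2 l g \<alpha> \<beta>"
    using edge_sol_bound[where \<kappa> = \<kappa> and l = l] by metis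
  show thesis
  proof (rule that[of "l * K"])
    show "edge_norm2 l (edge_sol \<kappa> g \<alpha> \<beta>) \<le> l * K * data_norm2 l g \<alpha> \<beta>" if g: "sqint l g" for g \<alpha> \<beta>
      using edge_norm2_le[OF assms(2) sqint_edge_sol[OF assms(1) g] K(2)[OF g]]
      by (simp add: mult.assoc)
  qed (use K assms in simp)
qed

lemma homogeneous_wronskian:
  assumes "\<kappa> \<noteq> 0"
  shows "edge_sol \<kappa> (\<lambda>_. 0) \<alpha> \<beta> t * cs \<kappa> t - edge_sol' \<kappa> (\<lambda>_. 0) \<alpha> \<beta> t * sn \<kappa> t = \<alpha>"
proof -
  have "edge_sol \<kappa> (\<lambda>_. 0) \<alpha> \<beta> t * cs \<kappa> t - edge_sol' \<kappa> (\<lambda>_. 0) \<alpha> \<beta> t * sn \<kappa> t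
      = ((cs \<kappa> t)\<^sup>2 + \<kappa>\<^sup>2 * (sn \<kappa> t)\<^sup>2) * \<alpha>"
    by (simp add: edge_sol_homogeneous power2_eq_square algebra_simps)
  then show ?thesis by (simp add: cs_sn_pythagoras[OF assms])
qed

text \<open>Since \<open>u cs - u' sn = \<alpha>\<close> for every homogeneous solution, the derivative of
  \<open>(l - t) sn u - (l - t)\<^sup>2 \<alpha> / 2\<close> does not involve \<open>u'\<close>; hence the initial value is controlled by
  the \<open>L\<^sup>2\<close> norm alone.\<close>

lemma homogeneous_initial_value:
  assumes \<kappa>: "\<kappa> \<noteq> 0" and l: "l > 0"
  defines "u \<equiv> \<lambda>\<alpha> \<beta>. edge_sol \<kappa> (\<lambda>_. 0) \<alpha> \<beta>" and "k \<equiv> \<lambda>t. 2 * of_real (l - t) * cs \<kappa> t - sn \<kappa> t"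
  shows "of_real (l\<^sup>2 / 2) * \<alpha> = prim (\<lambda>t. k t * u \<alpha> \<beta> t) l"
proof -
  define p where "p t = complex_of_real (l - t)" for t
  define F where "F t = p t * (sn \<kappa> t * u \<alpha> \<beta> t) - p t * p t * (\<alpha> / 2)" for t
  let ?u' = "edge_sol' \<kappa> (\<lambda>_. 0) \<alpha> \<beta>"
  have h: "helmholtz \<kappa> l (\<lambda>_. 0) (u \<alpha> \<beta>) ?u'"
    unfolding u_def by (rule helmholtz_edge_sol[OF \<kappa>]) (rule sqint_if_continuous_on, simp)
  have wronskian: "u \<alpha> \<beta> t * cs \<kappa> t - ?u' t * sn \<kappa> t = \<alpha>" for t
    unfolding u_def by (rule homogeneous_wronskian[OF \<kappa>])
  have deriv: "(F has_vector_derivative k t * u \<alpha> \<beta> t) (at t within {0..l})" if t: "t \<in> {0..l}" for t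
  proof -
    have p: "(p has_vector_derivative - 1) (at t within {0..l})"
      unfolding p_def[abs_def] by (auto intro!: derivative_eq_intros)
    have u: "(u \<alpha> \<beta> has_vector_derivative ?u' t) (at t within {0..l})"
      using h t by (simp add: helmholtz_def)
    have "(F has_vector_derivative
        (p t * (sn \<kappa> t * ?u' t + cs \<kappa> t * u \<alpha> \<beta> t) + - 1 * (sn \<kappa> t * u \<alpha> \<beta> t))
        - (p t * - 1 + - 1 * p t) * (\<alpha> / 2)) (at t within {0..l})"
      unfolding F_def[abs_def]
      by (intro has_vector_derivative_diff has_vector_derivative_mult_left has_vector_derivative_mult
          p u sn_has_vector_derivative[OF \<kappa>])
    also have "(p t * (sn \<kappa> t * ?u' t + cs \<kappa> t * u \<alpha> \<beta> t) + - 1 * (sn \<kappa> t * u \<alpha> \<beta> t))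
        - (p t * - 1 + - 1 * p t) * (\<alpha> / 2)
      = k t * u \<alpha> \<beta> t + p t * (\<alpha> - (u \<alpha> \<beta> t * cs \<kappa> t - ?u' t * sn \<kappa> t))"
      by (simp add: k_def p_def algebra_simps)
    finally show ?thesis by (simp add: wronskian)
  qed
  have "continuous_on {0..l} (\<lambda>t. k t * u \<alpha> \<beta> t)"
    unfolding k_def
    by (intro continuous_intros continuous_on_cs continuous_on_sn helmholtz_continuous_on[OF h])
  then have "\<forall>t\<in>{0..l}. F t = F 0 + prim (\<lambda>t. k t * u \<alpha> \<beta> t) t"
    by (rule has_vector_derivative_iff_eq_prim[THEN iffD1]) (blast intro: deriv)
  from bspec[OF this, of l] have "F l = F 0 + prim (\<lambda>t. k t * u \<alpha> \<beta> t) l" using l by simp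
  then show ?thesis by (simp add: F_def p_def power2_eq_square)
qed

lemma homogeneous_initial_value_le:
  assumes \<kappa>: "\<kappa> \<noteq> 0" and l: "l > 0"
  obtains K where "K \<ge> 0" "\<And>\<alpha> \<beta>. (cmod \<alpha>)\<^sup>2 \<le> K * edge_norm2 l (edge_sol \<kappa> (\<lambda>_. 0) \<alpha> \<beta>)"
proof -
  let ?u = "edge_sol \<kappa> (\<lambda>_. 0)"
  define k where "k t = 2 * complex_of_real (l - t) * cs \<kappa> t - sn \<kappa> t" for t
  have k: "continuous_on {0..l} k"
    unfolding k_def[abs_def] by (intro continuous_intros continuous_on_cs continuous_on_sn)
  obtain M where M: "\<And>t. t \<in> {0..l} \<Longrightarrow> cmod (k t) \<le> M"
    using compact_imp_bounded[OF compact_continuous_image[OF k compact_Icc]]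
    unfolding bounded_iff by blast
  have h: "helmholtz \<kappa> l (\<lambda>_. 0) (?u \<alpha> \<beta>) (edge_sol' \<kappa> (\<lambda>_. 0) \<alpha> \<beta>)" for \<alpha> \<beta>
    by (rule helmholtz_edge_sol[OF \<kappa>]) (rule sqint_if_continuous_on, simp)
  show thesis
  proof
    show "(2 / l\<^sup>2)\<^sup>2 * (l * M\<^sup>2) \<ge> 0" using l by simp
    fix \<alpha> \<beta>
    have u: "sqint l (?u \<alpha> \<beta>)" and ku: "sqint l (\<lambda>t. k t * ?u \<alpha> \<beta> t)"
      by (intro sqint_if_continuous_on continuous_intros k helmholtz_continuous_on[OF h])+
    have "\<alpha> = of_real (2 / l\<^sup>2) * prim (\<lambda>t. k t * ?u \<alpha> \<beta> t) l"
      unfolding k_def homogeneous_initial_value[OF assms, of \<alpha> \<beta>, symmetric] using l by simp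
    from arg_cong[OF this, of "\<lambda>w. (cmod w)\<^sup>2"]
    have "(cmod \<alpha>)\<^sup>2 = (2 / l\<^sup>2)\<^sup>2 * (cmod (prim (\<lambda>t. k t * ?u \<alpha> \<beta> t) l))\<^sup>2"
      by (simp only: norm_mult norm_of_real power_mult_distrib power2_abs)
    also have "\<dots> \<le> (2 / l\<^sup>2)\<^sup>2 * (l * edge_norm2 l (\<lambda>t. k t * ?u \<alpha> \<beta> t))"
      using l by (intro mult_left_mono cmod_prim_power2_le[OF ku]) auto
    also have "\<dots> \<le> (2 / l\<^sup>2)\<^sup>2 * (l * (M\<^sup>2 * edge_norm2 l (?u \<alpha> \<beta>)))"
      using l by (intro mult_left_mono edge_norm2_mult_le[OF u M ku]) auto
    finally show "(cmod \<alpha>)\<^sup>2 \<le> (2 / l\<^sup>2)\<^sup>2 * (l * M\<^sup>2) * edge_norm2 l (?u \<alpha> \<beta>)"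
      by (simp add: mult.assoc)
  qed
qed

lemma initial_value_le:
  assumes \<kappa>: "\<kappa> \<noteq> 0" and l: "l > 0"
  obtains K where "\<And>g \<alpha> \<beta>. sqint l g \<Longrightarrow>
    (cmod \<alpha>)\<^sup>2 \<le> K * (edge_norm2 l g + edge_norm2 l (edge_sol \<kappa> g \<alpha> \<beta>))"
proof -
  obtain K where K: "K \<ge> 0" "\<And>\<alpha> \<beta>. (cmod \<alpha>)\<^sup>2 \<le> K * edge_norm2 l (edge_sol \<kappa> (\<lambda>_. 0) \<alpha> \<beta>)"
    using homogeneous_initial_value_le[OF assms] by metis
  obtain L where L: "L \<ge> 0"
    "\<And>g \<alpha> \<beta>. sqint l g \<Longrightarrow> edge_norm2 l (edge_sol \<kappa> g \<alpha> \<beta>) \<le> L * data_norm2 l g \<alpha> \<beta>"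
    by (rule edge_norm2_edge_sol_le[OF \<kappa> less_imp_le[OF l]]) (rule that)
  show thesis
  proof
    fix g \<alpha> \<beta> assume g: "sqint l g"
    have neg: "sqint l (\<lambda>t. - edge_sol \<kappa> g 0 0 t)"
      using sqint_cmult[OF sqint_edge_sol[OF \<kappa> g], of "-1"] by simp
    have "edge_norm2 l (edge_sol \<kappa> (\<lambda>_. 0) \<alpha> \<beta>)
      = edge_norm2 l (\<lambda>t. edge_sol \<kappa> g \<alpha> \<beta> t + - edge_sol \<kappa> g 0 0 t)"
      by (rule edge_norm2_cong) (simp add: edge_sol_homogeneous edge_sol_split(1)[of \<kappa> g \<alpha> \<beta>])
    also have "\<dots> \<le> 2 * (edge_norm2 l (edge_sol \<kappa> g \<alpha> \<beta>) + edge_norm2 l (edge_sol \<kappa> g 0 0))"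
      using edge_norm2_add_le[OF sqint_edge_sol[OF \<kappa> g] neg] by (simp add: edge_norm2_def)
    also have "\<dots> \<le> 2 * (edge_norm2 l (edge_sol \<kappa> g \<alpha> \<beta>) + L * edge_norm2 l g)"
      using L(2)[OF g, of 0 0] by (simp add: data_norm2_def)
    also have "\<dots> \<le> 2 * (1 + L) * (edge_norm2 l g + edge_norm2 l (edge_sol \<kappa> g \<alpha> \<beta>))"
      using L(1) edge_norm2_nonneg[of l g] edge_norm2_nonneg[of l "edge_sol \<kappa> g \<alpha> \<beta>"]
      by (simp add: algebra_simps)
    finally have "K * edge_norm2 l (edge_sol \<kappa> (\<lambda>_. 0) \<alpha> \<beta>)
        \<le> K * (2 * (1 + L) * (edge_norm2 l g + edge_norm2 l (edge_sol \<kappa> g \<alpha> \<beta>)))"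
      using K(1) by (rule mult_left_mono)
    with K(2)[of \<alpha> \<beta>]
    show "(cmod \<alpha>)\<^sup>2 \<le> K * (2 * (1 + L)) * (edge_norm2 l g + edge_norm2 l (edge_sol \<kappa> g \<alpha> \<beta>))"
      by (simp only: mult.assoc order_trans)
  qed
qed

section \<open>Square-summable solutions of the three-term recurrence\<close>

definition ell2 :: "(int \<Rightarrow> complex) \<Rightarrow> bool" where
  "ell2 y \<longleftrightarrow> (\<lambda>j. (cmod (y j))\<^sup>2) summable_on UNIV"

lemma ell2_comparison:
  assumes "f summable_on UNIV" "\<And>j. (cmod (y j))\<^sup>2 \<le> f j"
  shows "ell2 y"
  unfolding ell2_def by (rule summable_on_comparison_test[OF assms(1)]) (use assms(2) in auto)

lemma ell2_add: "ell2 x \<Longrightarrow> ell2 y \<Longrightarrow> ell2 (\<lambda>j. x j + y j)"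
  by (rule ell2_comparison[of "\<lambda>j. 2 * ((cmod (x j))\<^sup>2 + (cmod (y j))\<^sup>2)"])
    (auto simp: ell2_def simp del: distrib_left_numeral
      intro!: summable_on_cmult_right summable_on_add cmod_add_power2_le)

lemma ell2_cmult: "ell2 x \<Longrightarrow> ell2 (\<lambda>j. c * x j)"
  unfolding ell2_def norm_mult power_mult_distrib by (rule summable_on_cmult_right)

lemma ell2_diff: "ell2 x \<Longrightarrow> ell2 y \<Longrightarrow> ell2 (\<lambda>j. x j - y j)"
  using ell2_add[OF _ ell2_cmult[of y "-1"]] by simp

lemma ell2_reindex:
  assumes "bij \<pi>" "ell2 x"
  shows "ell2 (\<lambda>j. x (\<pi> j))"
  using summable_on_reindex_bij_betw[OF assms(1), of "\<lambda>j. (cmod (x j))\<^sup>2"] assms(2)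
  by (simp add: ell2_def)

lemma ell2_shift: "ell2 x \<Longrightarrow> ell2 (\<lambda>j. x (j + k))"
  by (rule ell2_reindex) (rule bij_plus_right)

lemma ell2_reflect: "ell2 x \<Longrightarrow> ell2 (\<lambda>j. x (- j))"
  by (rule ell2_reindex) (rule bij_uminus)

lemma ell2_bounded:
  assumes "ell2 h"
  obtains C where "\<And>j. cmod (h j) \<le> C"
proof
  fix j
  have "(\<Sum>i\<in>{j}. (cmod (h i))\<^sup>2) \<le> infsum (\<lambda>i. (cmod (h i))\<^sup>2) UNIV"
    using assms unfolding ell2_def by (intro finite_sum_le_infsum) auto
  then show "cmod (h j) \<le> sqrt (infsum (\<lambda>i. (cmod (h i))\<^sup>2) UNIV)" by (intro real_le_rsqrt) simp
qed

lemma ell2_tendsto_0: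
  assumes "ell2 y" and \<phi>: "inj (\<phi> :: nat \<Rightarrow> int)"
  shows "(\<lambda>n. y (\<phi> n)) \<longlonglongrightarrow> 0"
proof -
  have "(\<lambda>j. (cmod (y j))\<^sup>2) summable_on range \<phi>"
    using assms(1) unfolding ell2_def by (rule summable_on_subset_banach) simp
  then have "(\<lambda>n. (cmod (y (\<phi> n)))\<^sup>2) summable_on UNIV"
    by (subst (asm) summable_on_reindex[OF \<phi>]) (simp add: comp_def)
  then have "(\<lambda>n. (cmod (y (\<phi> n)))\<^sup>2) \<longlonglongrightarrow> 0"
    by (intro summable_LIMSEQ_zero summable_on_imp_summable)
  from tendsto_real_sqrt[OF this] show ?thesis by (simp add: tendsto_norm_zero_iff)
qed

lemma summable_on_int_if_contracting:
  fixes f g :: "int \<Rightarrow> real"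
  assumes f: "\<And>j. 0 \<le> f j" "\<And>j. f j \<le> B" and r: "0 \<le> r" "r < 1"
    and g: "\<And>j. 0 \<le> g j" "g summable_on UNIV" and step: "\<And>j. f j \<le> r * f (j - 1) + g j"
  shows "f summable_on UNIV"
proof (rule nonneg_bdd_above_summable_on[OF f(1)], rule bdd_aboveI)
  fix s assume "s \<in> sum f ` {F. F \<subseteq> UNIV \<and> finite F}"
  then obtain F where F: "finite F" "s = sum f F" by auto
  obtain N where N: "F \<subseteq> {-N..N}"
  proof
    show "F \<subseteq> {- Max (insert 0 (abs ` F))..Max (insert 0 (abs ` F))}"
    proof
      fix x assume "x \<in> F"
      then have "\<bar>x\<bar> \<le> Max (insert 0 (abs ` F))" using F(1) by (intro Max_ge) auto
      then show "x \<in> {- Max (insert 0 (abs ` F))..Max (insert 0 (abs ` F))}" by auto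
    qed
  qed
  define S where "S = sum f {-N..N}"
  have shifted: "(\<Sum>j\<in>{-N..N}. f (j - 1)) \<le> B + S"
  proof -
    have "(\<Sum>j\<in>{-N..N}. f (j - 1)) = sum f ((\<lambda>j. j - 1) ` {-N..N})"
      by (subst sum.reindex) (auto simp: inj_on_def)
    also have "\<dots> \<le> sum f (insert (-N - 1) {-N..N})" by (rule sum_mono2) (auto simp: f)
    also have "\<dots> = f (-N - 1) + S" by (subst sum.insert) (auto simp: S_def)
    finally show ?thesis using f(2)[of "-N - 1"] by simp
  qed
  have "S \<le> (\<Sum>j\<in>{-N..N}. r * f (j - 1) + g j)" unfolding S_def by (rule sum_mono[OF step])
  also have "\<dots> = r * (\<Sum>j\<in>{-N..N}. f (j - 1)) + (\<Sum>j\<in>{-N..N}. g j)"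
    by (simp add: sum.distrib sum_distrib_left)
  also have "\<dots> \<le> r * (B + S) + infsum g UNIV"
    by (intro add_mono mult_left_mono shifted r finite_sum_le_infsum g) auto
  finally have "S \<le> (r * B + infsum g UNIV) / (1 - r)"
    using r by (simp add: pos_le_divide_eq algebra_simps)
  moreover have "s \<le> S" unfolding F(2) S_def using N by (intro sum_mono2 f) auto
  ultimately show "s \<le> (r * B + infsum g UNIV) / (1 - r)" by simp
qed

lemma first_order_bounded_solution:
  fixes z :: complex
  assumes z: "cmod z < 1" and h: "\<And>j :: int. cmod (h j) \<le> C"
  obtains A where "\<And>j. A j = z * A (j - 1) + h j" "\<And>j. cmod (A j) \<le> (\<Sum>n. cmod z ^ n * C)"
proof
  have le: "cmod (z ^ n * h (j - int n)) \<le> cmod z ^ n * C" for n j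
    unfolding norm_mult norm_power by (intro mult_left_mono h) auto
  have geometric: "summable (\<lambda>n. cmod z ^ n * C)"
    using z by (intro summable_mult2 summable_geometric) auto
  have sum: "summable (\<lambda>n. z ^ n * h (j - int n))" for j
    by (rule summable_comparison_test'[OF geometric le])
  fix j
  have "(\<Sum>n. z ^ n * h (j - int n)) = (\<Sum>n. z ^ Suc n * h (j - int (Suc n))) + h j"
    using suminf_split_head[OF sum[of j]] by simp
  also have "(\<Sum>n. z ^ Suc n * h (j - int (Suc n))) = (\<Sum>n. z * (z ^ n * h (j - 1 - int n)))"
    by (simp add: algebra_simps)
  also have "\<dots> = z * (\<Sum>n. z ^ n * h (j - 1 - int n))" by (rule suminf_mult[OF sum])
  finally show "(\<Sum>n. z ^ n * h (j - int n)) = z * (\<Sum>n. z ^ n * h (j - 1 - int n)) + h j" .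
  show "cmod (\<Sum>n. z ^ n * h (j - int n)) \<le> (\<Sum>n. cmod z ^ n * C)"
    by (rule norm_suminf_le[OF le geometric])
qed

lemma power2_convex_combination_le:
  fixes r x k :: real
  assumes "0 \<le> r" "r < 1"
  shows "(r * x + k)\<^sup>2 \<le> r * x\<^sup>2 + k\<^sup>2 / (1 - r)"
proof -
  have "(r * x\<^sup>2 + k\<^sup>2 / (1 - r)) - (r * x + k)\<^sup>2 = r / (1 - r) * ((1 - r) * x - k)\<^sup>2"
    using assms by (simp add: field_simps power2_eq_square)
  also have "\<dots> \<ge> 0" using assms by simp
  finally show ?thesis by simp
qed

lemma first_order_forward_solution:
  assumes z: "cmod z < 1" and h: "ell2 h"
  obtains A where "ell2 A" "\<And>j. A j = z * A (j - 1) + h j"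
proof -
  obtain C where "\<And>j. cmod (h j) \<le> C" using ell2_bounded[OF h] by metis
  then obtain A where A: "\<And>j. A j = z * A (j - 1) + h j" "\<And>j. cmod (A j) \<le> (\<Sum>n. cmod z ^ n * C)"
    using first_order_bounded_solution[OF z] by metis
  have "(\<lambda>j. (cmod (A j))\<^sup>2) summable_on UNIV"
  proof (rule summable_on_int_if_contracting)
    show "(\<lambda>j. (cmod (h j))\<^sup>2 / (1 - cmod z)) summable_on UNIV"
      using h by (simp add: ell2_def divide_inverse summable_on_cmult_left)
    fix j
    show "(cmod (A j))\<^sup>2 \<le> (\<Sum>n. cmod z ^ n * C)\<^sup>2" by (intro power_mono A) auto
    have "(cmod (A j))\<^sup>2 \<le> (cmod z * cmod (A (j - 1)) + cmod (h j))\<^sup>2"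
      unfolding A(1)[of j] by (intro power_mono) (metis norm_mult norm_triangle_ineq, simp)
    also have "\<dots> \<le> cmod z * (cmod (A (j - 1)))\<^sup>2 + (cmod (h j))\<^sup>2 / (1 - cmod z)"
      using z by (intro power2_convex_combination_le) auto
    finally show "(cmod (A j))\<^sup>2 \<le> cmod z * (cmod (A (j - 1)))\<^sup>2 + (cmod (h j))\<^sup>2 / (1 - cmod z)" .
  qed (use z in auto)
  then show thesis by (intro that[OF _ A(1)]) (simp add: ell2_def)
qed

lemma first_order_backward_solution:
  assumes "cmod z < 1" "ell2 h"
  obtains B where "ell2 B" "\<And>j. B j = z * B (j + 1) + h j"
proof -
  obtain A where A: "ell2 A" "\<And>j. A j = z * A (j - 1) + h (- j)"
    by (rule first_order_forward_solution[OF assms(1) ell2_reflect[OF assms(2)]]) (rule that)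
  show thesis
  proof
    show "ell2 (\<lambda>j. A (- j))" by (rule ell2_reflect[OF A(1)])
    show "A (- j) = z * A (- (j + 1)) + h j" for j using A(2)[of "- j"] by simp
  qed
qed

definition three_term :: "(int \<Rightarrow> complex) \<Rightarrow> (int \<Rightarrow> complex) \<Rightarrow> (int \<Rightarrow> complex) \<Rightarrow> bool" where
  "three_term F h y \<longleftrightarrow> (\<forall>j. y (j + 1) + y (j - 1) - 2 * F j * y j = h j)"

definition decay_root :: "complex \<Rightarrow> complex \<Rightarrow> bool" where
  "decay_root F z \<longleftrightarrow> z \<noteq> 0 \<and> cmod z < 1 \<and> z + 1 / z = 2 * F"

text \<open>With the shift \<open>T\<close> the operator factors as \<open>T + T\<^sup>-\<^sup>1 - 2 F = (T - z) (1 - T\<^sup>-\<^sup>1 / z)\<close>, and each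
  factor is inverted by a geometric series in \<open>z\<close>.\<close>

lemma three_term_const_solvable:
  assumes z: "decay_root F z" and h: "ell2 h"
  obtains x where "ell2 x" "three_term (\<lambda>_. F) h x"
proof -
  have z': "z \<noteq> 0" "cmod z < 1" "2 * F = z + 1 / z" using z by (simp_all add: decay_root_def)
  have "ell2 (\<lambda>j. h (j - 1))" using ell2_shift[OF h, of "-1"] by simp
  then obtain w where w: "ell2 w" "\<And>j. w j = z * w (j - 1) + h (j - 1)"
    by (rule first_order_forward_solution[OF z'(2)]) (rule that)
  have "ell2 (\<lambda>j. - z * w (j + 1))" by (intro ell2_cmult ell2_shift w(1))
  then obtain x where x: "ell2 x" "\<And>j. x j = z * x (j + 1) + - z * w (j + 1)"
    by (rule first_order_backward_solution[OF z'(2)]) (rule that)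
  show thesis
  proof
    show "three_term (\<lambda>_. F) h x"
      unfolding three_term_def
    proof
      fix j :: int
      have w_eq: "w i = x i - x (i - 1) / z" for i
        using x(2)[of "i - 1"] z'(1) by (simp add: field_simps)
      have h_eq: "h j = (x (j + 1) - x j / z) - z * (x j - x (j - 1) / z)"
        using w(2)[of "j + 1"] w_eq[of j] w_eq[of "j + 1"] by simp
      show "x (j + 1) + x (j - 1) - 2 * F * x j = h j"
        unfolding z'(3) h_eq using z'(1) by (simp add: field_simps)
    qed
  qed (rule x(1))
qed

lemma ell2_power_abs:
  assumes "cmod z < 1"
  shows "ell2 (\<lambda>j. z ^ nat \<bar>j\<bar>)"
proof -
  define r where "r = (cmod z)\<^sup>2"
  have r: "0 \<le> r" "r < 1" using assms by (auto simp: r_def abs_square_less_1)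
  have geometric: "(\<lambda>n. r ^ n) summable_on UNIV"
    using r by (subst summable_on_UNIV_nonneg_real_iff) (auto intro: summable_geometric)
  have "(\<lambda>j. r ^ nat \<bar>j\<bar>) summable_on range int" "(\<lambda>j. r ^ nat \<bar>j\<bar>) summable_on range (\<lambda>n. - int n)"
    by (subst summable_on_reindex; use geometric in \<open>auto simp: comp_def inj_on_def\<close>)+
  then have "(\<lambda>j. r ^ nat \<bar>j\<bar>) summable_on (range int \<union> range (\<lambda>n. - int n))"
    by (rule summable_on_union)
  moreover have "j \<in> range int \<union> range (\<lambda>n. - int n)" for j by (cases j rule: int_cases2) auto
  then have "range int \<union> range (\<lambda>n. - int n) = UNIV" by blast
  moreover have "(cmod (z ^ nat \<bar>j\<bar>))\<^sup>2 = r ^ nat \<bar>j\<bar>" for j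
    by (simp add: r_def norm_power power_mult[symmetric] mult.commute)
  ultimately show ?thesis by (simp add: ell2_def)
qed

lemma three_term_power_abs:
  assumes z: "z \<noteq> 0" "z + 1 / z = 2 * F"
  shows "three_term ((\<lambda>_. F)(0 := Ft)) ((\<lambda>_. 0)(0 := 2 * (z - Ft))) (\<lambda>j. z ^ nat \<bar>j\<bar>)"
  unfolding three_term_def
proof
  fix j :: int
  have step: "z ^ Suc (Suc n) + z ^ n - 2 * F * z ^ Suc n = 0" for n
    unfolding z(2)[symmetric] using z(1) by (simp add: field_simps)
  consider "j = 0" | n where "j = int (Suc n)" | n where "j = - int (Suc n)"
    by (metis int_cases not0_implies_Suc of_nat_0)
  then show "z ^ nat \<bar>j + 1\<bar> + z ^ nat \<bar>j - 1\<bar> - 2 * ((\<lambda>_. F)(0 := Ft)) j * z ^ nat \<bar>j\<bar>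
      = ((\<lambda>_. 0)(0 := 2 * (z - Ft))) j"
  proof cases
    case (2 n)
    then have "nat \<bar>j + 1\<bar> = Suc (Suc n)" "nat \<bar>j - 1\<bar> = n" "nat \<bar>j\<bar> = Suc n" "j \<noteq> 0" by auto
    then show ?thesis using step[of n] by simp
  next
    case (3 n)
    then have "nat \<bar>j - 1\<bar> = Suc (Suc n)" "nat \<bar>j + 1\<bar> = n" "nat \<bar>j\<bar> = Suc n" "j \<noteq> 0" by auto
    then show ?thesis using step[of n] by (simp add: add.commute)
  qed (simp add: algebra_simps)
qed

lemma three_term_perturbed_solvable:
  assumes z: "decay_root F z" and "Ft \<noteq> z" and h: "ell2 h"
  obtains y where "ell2 y" "three_term ((\<lambda>_. F)(0 := Ft)) h y"
proof -
  have z': "z \<noteq> 0" "cmod z < 1" "z + 1 / z = 2 * F" using z by (simp_all add: decay_root_def)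
  obtain x where x: "ell2 x" "three_term (\<lambda>_. F) h x" using three_term_const_solvable[OF z h] by metis
  define c where "c = (Ft - F) * x 0 / (z - Ft)"
  let ?e = "\<lambda>j :: int. z ^ nat \<bar>j\<bar>"
  show thesis
  proof
    show "ell2 (\<lambda>j. x j + c * ?e j)" by (intro ell2_add ell2_cmult x(1) ell2_power_abs z')
    show "three_term ((\<lambda>_. F)(0 := Ft)) h (\<lambda>j. x j + c * ?e j)"
      unfolding three_term_def
    proof
      fix j :: int
      let ?F = "((\<lambda>_. F)(0 := Ft)) j"
      have "(x (j+1) + c * ?e (j+1)) + (x (j-1) + c * ?e (j-1)) - 2 * ?F * (x j + c * ?e j)
        = (x (j+1) + x (j-1) - 2 * F * x j) + 2 * (F - ?F) * x j
          + c * (?e (j+1) + ?e (j-1) - 2 * ?F * ?e j)"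
        by (simp only: algebra_simps)
      also have "\<dots> = h j + 2 * (F - ?F) * x j + c * ((\<lambda>_. 0)(0 := 2 * (z - Ft))) j"
        using x(2) three_term_power_abs[OF z'(1,3), of Ft] unfolding three_term_def by simp
      also have "\<dots> = h j" using assms(2) by (simp add: c_def field_simps)
      finally show
        "(x (j+1) + c * ?e (j+1)) + (x (j-1) + c * ?e (j-1)) - 2 * ?F * (x j + c * ?e j) = h j" .
    qed
  qed
qed

lemma half_line_geometric:
  fixes y :: "nat \<Rightarrow> complex"
  assumes z: "z \<noteq> 0" "cmod z \<le> 1"
    and rec: "\<And>n. y (Suc (Suc n)) + y n = (z + 1 / z) * y (Suc n)" and lim: "y \<longlonglongrightarrow> 0"
  shows "y n = z ^ n * y 0"
proof -
  define w where "w n = y (Suc n) - z * y n" for n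
  have w_Suc: "w n = z * w (Suc n)" for n
  proof -
    have "z * (y (Suc (Suc n)) + y n) = (z * z + 1) * y (Suc n)"
      unfolding rec using z(1) by (simp add: field_simps)
    then show ?thesis by (simp add: w_def algebra_simps)
  qed
  have "incseq (\<lambda>n. cmod (w n))"
  proof (rule incseq_SucI)
    show "cmod (w n) \<le> cmod (w (Suc n))" for n
      using mult_right_mono[OF z(2), of "cmod (w (Suc n))"] by (simp add: w_Suc[of n] norm_mult)
  qed
  moreover have "(\<lambda>n. cmod (w n)) \<longlonglongrightarrow> cmod (0 - z * 0)"
    unfolding w_def[abs_def] by (intro tendsto_intros LIMSEQ_Suc lim)
  ultimately have "cmod (w n) \<le> cmod (0 - z * 0)" for n by (rule incseq_le)
  then have "y (Suc n) = z * y n" for n by (simp add: w_def)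
  then show ?thesis by (induction n) simp_all
qed

lemma three_term_perturbed_eq_power_abs:
  fixes y :: "int \<Rightarrow> complex"
  assumes z: "z \<noteq> 0" "cmod z \<le> 1" "z + 1 / z = 2 * F"
    and y: "ell2 y" "three_term ((\<lambda>_. F)(0 := Ft)) ((\<lambda>_. 0)(0 := s)) y"
  shows "y j = z ^ nat \<bar>j\<bar> * y 0" and "2 * (z - Ft) * y 0 = s"
proof -
  have rec: "y (j + 1) + y (j - 1) = (z + 1 / z) * y j" if "j \<noteq> 0" for j
    using y(2) that unfolding three_term_def z(3) by (metis eq_iff_diff_eq_0 fun_upd_other)
  have right: "y (int n) = z ^ n * y (int 0)" for n
  proof (rule half_line_geometric[OF z(1,2) _ ell2_tendsto_0[OF y(1)]])
    show "y (int (Suc (Suc n))) + y (int n) = (z + 1 / z) * y (int (Suc n))" for n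
      using rec[of "int (Suc n)"] by (simp add: algebra_simps)
  qed simp
  have left: "y (- int n) = z ^ n * y (- int 0)" for n
  proof (rule half_line_geometric[OF z(1,2) _ ell2_tendsto_0[OF y(1)]])
    show "y (- int (Suc (Suc n))) + y (- int n) = (z + 1 / z) * y (- int (Suc n))" for n
      using rec[of "- int (Suc n)"] by (simp add: algebra_simps)
  qed (simp add: inj_on_def)
  show power: "y j = z ^ nat \<bar>j\<bar> * y 0" for j
    using right[of "nat j"] left[of "nat (- j)"] by (cases "j \<ge> 0") auto
  have "y 1 + y (- 1) - 2 * Ft * y 0 = s" using y(2)[unfolded three_term_def, rule_format, of 0] by simp
  then show "2 * (z - Ft) * y 0 = s" using power[of 1] power[of "- 1"] by (simp add: algebra_simps)
qed

lemma unit_root_exists: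
  assumes "F \<in> complex_of_real ` {-1..1}"
  obtains z where "cmod z = 1" "z + 1 / z = 2 * F"
proof -
  obtain x where x: "F = of_real x" "-1 \<le> x" "x \<le> 1" using assms by auto
  have "1 / cis (arccos x) = cis (- arccos x)" by (simp only: inverse_eq_divide[symmetric] cis_inverse)
  then have "cis (arccos x) + 1 / cis (arccos x) = 2 * F" using x by (simp add: complex_eq_iff)
  then show thesis by (intro that[of "cis (arccos x)"]) simp_all
qed

lemma decay_root_not_in_band:
  assumes "decay_root F z"
  shows "F \<notin> complex_of_real ` {-1..1}"
proof
  assume "F \<in> complex_of_real ` {-1..1}"
  then obtain x where x: "F = of_real x" "x\<^sup>2 \<le> 1" by (auto simp: abs_square_le_1)
  have z: "z \<noteq> 0" "cmod z < 1" "z + 1 / z = 2 * of_real x"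
    using assms x(1) by (simp_all add: decay_root_def)
  have "(z - of_real x)\<^sup>2 = of_real (x\<^sup>2 - 1)"
    using z(1,3) by (simp add: field_simps power2_eq_square)
  then have eq: "(Re z - x)\<^sup>2 - (Im z)\<^sup>2 = x\<^sup>2 - 1" "Re z = x \<or> Im z = 0"
    by (auto simp: complex_eq_iff power2_eq_square)
  have "Re z = x"
  proof (rule ccontr)
    assume "Re z \<noteq> x"
    then have "(Im z)\<^sup>2 = 0" "0 < (Re z - x)\<^sup>2" using eq(2) by simp_all
    then show False using eq(1) x(2) by linarith
  qed
  with eq(1) have "(Re z)\<^sup>2 + (Im z)\<^sup>2 = 1" by simp
  then show False using z(2) by (simp add: cmod_def)
qed

lemma decay_root_exists:
  assumes "F \<notin> complex_of_real ` {-1..1}"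
  obtains z where "decay_root F z"
proof -
  define w where "w = F + csqrt (F\<^sup>2 - 1)"
  have "(w - F)\<^sup>2 = F\<^sup>2 - 1" by (simp add: w_def)
  then have prod: "w * (2 * F - w) = 1" by (simp add: power2_eq_square algebra_simps)
  then have w0: "w \<noteq> 0" by auto
  with prod have sum: "w + 1 / w = 2 * F" by (simp add: field_simps)
  have "cmod w \<noteq> 1"
  proof
    assume "cmod w = 1"
    then have "1 / w = cnj w" using complex_div_cnj[of 1 w] by simp
    with sum have "2 * F = of_real (2 * Re w)" using complex_add_cnj[of w] by simp
    then have "F = of_real (Re w)" by simp
    moreover have "\<bar>Re w\<bar> \<le> 1" using abs_Re_le_cmod[of w] \<open>cmod w = 1\<close> by simp
    ultimately show False using assms by (auto simp: abs_le_iff)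
  qed
  then consider "cmod w < 1" | "cmod w > 1" by linarith
  then have "decay_root F w \<or> decay_root F (1 / w)"
    using w0 sum by cases (simp_all add: decay_root_def norm_divide add.commute)
  then show thesis using that by blast
qed

lemma decay_root_of_real:
  fixes f :: real
  assumes "\<bar>f\<bar> > 1"
  defines "z \<equiv> if f < -1 then f + sqrt (f\<^sup>2 - 1) else f - sqrt (f\<^sup>2 - 1)"
  shows "decay_root (of_real f) (of_real z)"
proof -
  define s where "s = sqrt (f\<^sup>2 - 1)"
  have "f\<^sup>2 > 1" using assms(1) one_less_power[of "\<bar>f\<bar>" 2] by simp
  then have s: "s > 0" "s\<^sup>2 = f\<^sup>2 - 1" by (simp_all add: s_def)
  have prod: "z * (2 * f - z) = 1"
    using s(2) unfolding z_def s_def[symmetric] by (auto simp: algebra_simps power2_eq_square)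
  then have z: "z \<noteq> 0" by auto
  have other: "\<bar>2 * f - z\<bar> > 1" using s(1) assms(1) by (auto simp: z_def s_def[symmetric])
  have "\<bar>z\<bar> * \<bar>2 * f - z\<bar> = 1" using prod by (simp flip: abs_mult)
  with other have "\<bar>z\<bar> = 1 / \<bar>2 * f - z\<bar>" by (simp add: eq_divide_eq)
  with other have "\<bar>z\<bar> < 1" by simp
  moreover have "z + 1 / z = 2 * f" using prod z by (simp add: field_simps)
  then have "complex_of_real z + 1 / of_real z = 2 * of_real f"
    by (metis of_real_1 of_real_add of_real_divide of_real_mult of_real_numeral)
  ultimately show ?thesis using z by (simp add: decay_root_def)
qed

section \<open>Reduction of the graph equation to the recurrence\<close>

type_synonym graph_fun = "int \<Rightarrow> etype \<Rightarrow> real \<Rightarrow> complex"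

lemma elen_simps [simp]: "elen a b Hor = a" "elen a b Up = b / 2" "elen a b Dn = b / 2"
  by (simp_all add: elen_def)

lemma L2g_iff:
  "L2g a b g \<longleftrightarrow> (\<forall>j e. sqint (elen a b e) (g j e)) \<and>
     (\<forall>e. (\<lambda>j. edge_norm2 (elen a b e) (g j e)) summable_on UNIV)"
proof -
  let ?n = "\<lambda>j e. edge_norm2 (elen a b e) (g j e)"
  have "(\<lambda>j. ?n j Hor + ?n j Up + ?n j Dn) summable_on UNIV \<longleftrightarrow> (\<forall>e. (\<lambda>j. ?n j e) summable_on UNIV)"
    (is "?sum \<longleftrightarrow> ?each")
  proof
    assume sum: ?sum
    have "?n j e \<le> ?n j Hor + ?n j Up + ?n j Dn" for j e
      by (cases e) (simp_all add: edge_norm2_nonneg)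
    then show ?each
      by (intro allI summable_on_comparison_test[OF sum]) (simp_all add: edge_norm2_nonneg)
  next
    assume ?each
    then show ?sum by (intro summable_on_add) blast+
  qed
  then show ?thesis by (simp add: L2g_def)
qed

text \<open>Half the trace of the monodromy matrix of the periodic comb; the function \<open>f\<close> for real \<open>\<kappa>\<close>.\<close>

definition discriminant :: "real \<Rightarrow> real \<Rightarrow> real \<Rightarrow> real \<Rightarrow> complex \<Rightarrow> complex" where
  "discriminant a b \<tau> \<gamma> \<kappa> =
     of_real \<gamma> * sn \<kappa> a / 2 + cs \<kappa> a + sn \<kappa> a * (cs \<kappa> b - of_real \<tau>) / sn \<kappa> b"

definition dirichlet_slope :: "complex \<Rightarrow> real \<Rightarrow> complex \<Rightarrow> complex \<Rightarrow> complex \<Rightarrow> complex" where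
  "dirichlet_slope \<kappa> l p y0 y1 = (y1 - cs \<kappa> l * y0 - p) / sn \<kappa> l"

lemma dirichlet_slope_iff:
  "sn \<kappa> l \<noteq> 0 \<Longrightarrow> p + y0 * cs \<kappa> l + \<beta> * sn \<kappa> l = y1 \<longleftrightarrow> \<beta> = dirichlet_slope \<kappa> l p y0 y1"
  by (auto simp: dirichlet_slope_def field_simps)

lemma dirichlet_end_slope:
  assumes "\<kappa> \<noteq> 0" "sn \<kappa> l \<noteq> 0"
  shows "sn \<kappa> l * (q + dirichlet_slope \<kappa> l p y0 y1 * cs \<kappa> l - \<kappa>\<^sup>2 * y0 * sn \<kappa> l)
    = sn \<kappa> l * q - cs \<kappa> l * p + cs \<kappa> l * y1 - y0"
proof -
  have "sn \<kappa> l * (q + dirichlet_slope \<kappa> l p y0 y1 * cs \<kappa> l - \<kappa>\<^sup>2 * y0 * sn \<kappa> l)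
    = sn \<kappa> l * q + cs \<kappa> l * (sn \<kappa> l * dirichlet_slope \<kappa> l p y0 y1) - \<kappa>\<^sup>2 * (sn \<kappa> l)\<^sup>2 * y0"
    by (simp add: algebra_simps power2_eq_square)
  also have "sn \<kappa> l * dirichlet_slope \<kappa> l p y0 y1 = y1 - cs \<kappa> l * y0 - p"
    using assms(2) by (simp add: dirichlet_slope_def)
  also have "sn \<kappa> l * q + cs \<kappa> l * (y1 - cs \<kappa> l * y0 - p) - \<kappa>\<^sup>2 * (sn \<kappa> l)\<^sup>2 * y0
    = sn \<kappa> l * q - cs \<kappa> l * p + cs \<kappa> l * y1 - ((cs \<kappa> l)\<^sup>2 + \<kappa>\<^sup>2 * (sn \<kappa> l)\<^sup>2) * y0"
    by (simp add: algebra_simps power2_eq_square)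
  finally show ?thesis by (simp add: cs_sn_pythagoras[OF assms(1)])
qed

locale comb =
  fixes a b \<theta> :: real and \<kappa> :: complex
  assumes a_pos: "a > 0" and b_pos: "b > 0" and \<kappa>_nonzero: "\<kappa> \<noteq> 0"
    and sn_a: "sn \<kappa> a \<noteq> 0" and sn_b: "sn \<kappa> b \<noteq> 0"
begin

abbreviation \<omega> :: complex where "\<omega> \<equiv> exp (\<i> * complex_of_real \<theta>)"
abbreviation \<omega>' :: complex where "\<omega>' \<equiv> exp (- (\<i> * complex_of_real \<theta>))"

lemma phase_cancel [simp]: "\<omega> * \<omega>' = 1" "\<omega>' * \<omega> = 1" "\<omega> * (\<omega>' * x) = x" "\<omega>' * (\<omega> * x) = x"
  by (simp_all add: exp_add[symmetric] mult.assoc[symmetric])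

lemma phase_sum: "\<omega> + \<omega>' = 2 * of_real (cos \<theta>)"
  by (simp add: cos_of_real[symmetric] cos_exp_eq)

lemma elen_pos: "elen a b e > 0"
  using a_pos b_pos by (cases e) auto

definition response :: "graph_fun \<Rightarrow> int \<Rightarrow> etype \<Rightarrow> complex" where
  "response g j e = edge_sol \<kappa> (g j e) 0 0 (elen a b e)"

definition response' :: "graph_fun \<Rightarrow> int \<Rightarrow> etype \<Rightarrow> complex" where
  "response' g j e = edge_sol' \<kappa> (g j e) 0 0 (elen a b e)"

lemma edge_sol_end:
  "edge_sol \<kappa> (g j e) \<alpha> \<beta> (elen a b e)
    = response g j e + \<alpha> * cs \<kappa> (elen a b e) + \<beta> * sn \<kappa> (elen a b e)"
  "edge_sol' \<kappa> (g j e) \<alpha> \<beta> (elen a b e)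
    = response' g j e + \<beta> * cs \<kappa> (elen a b e) - \<kappa>\<^sup>2 * \<alpha> * sn \<kappa> (elen a b e)"
  unfolding response_def response'_def by (rule edge_sol_split)+

text \<open>Going up from \<open>x\<^sub>j\<close> to \<open>x\<^sub>j\<^sup>+\<close> and on from \<open>x\<^sub>j\<^sup>-\<close> to \<open>x\<^sub>j\<close>, a quasi-periodic function traverses a
  loop of length \<open>b\<close>, along which it picks up the phase \<open>\<omega>\<close>.\<close>

definition loop_response :: "graph_fun \<Rightarrow> int \<Rightarrow> complex" where
  "loop_response g j =
     cs \<kappa> (b/2) * response g j Up + sn \<kappa> (b/2) * response' g j Up + \<omega> * response g j Dn"

definition loop_response' :: "graph_fun \<Rightarrow> int \<Rightarrow> complex" where
  "loop_response' g j =
     cs \<kappa> (b/2) * response' g j Up - \<kappa>\<^sup>2 * sn \<kappa> (b/2) * response g j Up + \<omega> * response' g j Dn"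

lemma loop_end:
  fixes g :: graph_fun and j y \<eta>
  defines "\<rho> \<equiv> \<omega>' * edge_sol \<kappa> (g j Up) y \<eta> (b/2)" and "\<sigma> \<equiv> \<omega>' * edge_sol' \<kappa> (g j Up) y \<eta> (b/2)"
  shows "\<omega> * edge_sol \<kappa> (g j Dn) \<rho> \<sigma> (b/2) = loop_response g j + y * cs \<kappa> b + \<eta> * sn \<kappa> b"
    and "\<omega> * edge_sol' \<kappa> (g j Dn) \<rho> \<sigma> (b/2) = loop_response' g j + \<eta> * cs \<kappa> b - \<kappa>\<^sup>2 * y * sn \<kappa> b"
proof -
  note up = edge_sol_end[of g j Up y \<eta>, simplified]
  note dn = edge_sol_end[of g j Dn \<rho> \<sigma>, simplified]
  note half = cs_half[OF \<kappa>_nonzero, of b] sn_half[of \<kappa> b]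
  have "\<omega> * edge_sol \<kappa> (g j Dn) \<rho> \<sigma> (b/2)
    = \<omega> * response g j Dn + (\<omega> * \<rho>) * cs \<kappa> (b/2) + (\<omega> * \<sigma>) * sn \<kappa> (b/2)"
    by (simp only: dn algebra_simps)
  then show "\<omega> * edge_sol \<kappa> (g j Dn) \<rho> \<sigma> (b/2) = loop_response g j + y * cs \<kappa> b + \<eta> * sn \<kappa> b"
    by (simp add: \<rho>_def \<sigma>_def up half loop_response_def algebra_simps power2_eq_square)
  have "\<omega> * edge_sol' \<kappa> (g j Dn) \<rho> \<sigma> (b/2)
    = \<omega> * response' g j Dn + (\<omega> * \<sigma>) * cs \<kappa> (b/2) - \<kappa>\<^sup>2 * (\<omega> * \<rho>) * sn \<kappa> (b/2)"
    by (simp only: dn algebra_simps)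
  then show "\<omega> * edge_sol' \<kappa> (g j Dn) \<rho> \<sigma> (b/2) = loop_response' g j + \<eta> * cs \<kappa> b - \<kappa>\<^sup>2 * y * sn \<kappa> b"
    by (simp add: \<rho>_def \<sigma>_def up half loop_response'_def algebra_simps power2_eq_square)
qed

definition up_slope :: "graph_fun \<Rightarrow> (int \<Rightarrow> complex) \<Rightarrow> int \<Rightarrow> complex" where
  "up_slope g y j = dirichlet_slope \<kappa> b (loop_response g j) (y j) (\<omega> * y j)"

fun start_value :: "graph_fun \<Rightarrow> (int \<Rightarrow> complex) \<Rightarrow> int \<Rightarrow> etype \<Rightarrow> complex" where
  "start_value g y j Hor = y (j - 1)"
| "start_value g y j Up = y j"
| "start_value g y j Dn = \<omega>' * edge_sol \<kappa> (g j Up) (y j) (up_slope g y j) (b/2)"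

fun start_slope :: "graph_fun \<Rightarrow> (int \<Rightarrow> complex) \<Rightarrow> int \<Rightarrow> etype \<Rightarrow> complex" where
  "start_slope g y j Hor = dirichlet_slope \<kappa> a (response g j Hor) (y (j - 1)) (y j)"
| "start_slope g y j Up = up_slope g y j"
| "start_slope g y j Dn = \<omega>' * edge_sol' \<kappa> (g j Up) (y j) (up_slope g y j) (b/2)"

definition graph_sol :: "graph_fun \<Rightarrow> (int \<Rightarrow> complex) \<Rightarrow> int \<Rightarrow> etype \<Rightarrow> real \<Rightarrow> complex" where
  "graph_sol g y j e = edge_sol \<kappa> (g j e) (start_value g y j e) (start_slope g y j e)"

definition graph_source :: "graph_fun \<Rightarrow> int \<Rightarrow> complex" where
  "graph_source g j = sn \<kappa> a * response' g j Hor - cs \<kappa> a * response g j Hor + response g (j + 1) Hor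
     + sn \<kappa> a / sn \<kappa> b *
       (loop_response g j + \<omega>' * (sn \<kappa> b * loop_response' g j - cs \<kappa> b * loop_response g j))"

abbreviation vertex_equation :: "(int \<Rightarrow> real) \<Rightarrow> graph_fun \<Rightarrow> (int \<Rightarrow> complex) \<Rightarrow> bool" where
  "vertex_equation c g y \<equiv> three_term (\<lambda>j. discriminant a b (cos \<theta>) (c j) \<kappa>) (graph_source g) y"

lemma flux_graph_sol:
  "sn \<kappa> a * (- edge_sol' \<kappa> (g j Hor) (start_value g y j Hor) (start_slope g y j Hor) a
      + start_slope g y (j + 1) Hor + start_slope g y j Up
      - edge_sol' \<kappa> (g j Dn) (start_value g y j Dn) (start_slope g y j Dn) (b/2) - of_real c * y j)
    = y (j + 1) + y (j - 1) - 2 * discriminant a b (cos \<theta>) c \<kappa> * y j - graph_source g j"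
proof -
  define H where "H = edge_sol' \<kappa> (g j Hor) (start_value g y j Hor) (start_slope g y j Hor) a"
  define V where "V = edge_sol' \<kappa> (g j Dn) (start_value g y j Dn) (start_slope g y j Dn) (b/2)"
  let ?P = "loop_response g j" and ?Q = "loop_response' g j"
  have hor_end: "sn \<kappa> a * H
    = sn \<kappa> a * response' g j Hor - cs \<kappa> a * response g j Hor + cs \<kappa> a * y j - y (j - 1)"
    unfolding H_def edge_sol_end(2)[of g j Hor, simplified] start_value.simps start_slope.simps
    by (rule dirichlet_end_slope[OF \<kappa>_nonzero sn_a])
  have hor_start: "sn \<kappa> a * start_slope g y (j + 1) Hor
    = y (j + 1) - cs \<kappa> a * y j - response g (j + 1) Hor"
    using sn_a by (simp add: dirichlet_slope_def)
  have "sn \<kappa> b * (\<omega> * V) = sn \<kappa> b * ?Q - cs \<kappa> b * ?P + cs \<kappa> b * (\<omega> * y j) - y j"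
    unfolding V_def start_value.simps start_slope.simps loop_end(2) up_slope_def
    by (rule dirichlet_end_slope[OF \<kappa>_nonzero sn_b])
  then have "\<omega>' * (\<omega> * (sn \<kappa> b * V)) = \<omega>' * (sn \<kappa> b * ?Q - cs \<kappa> b * ?P + cs \<kappa> b * (\<omega> * y j) - y j)"
    by (simp only: mult.left_commute)
  then have loop_end: "sn \<kappa> b * V = \<omega>' * (sn \<kappa> b * ?Q - cs \<kappa> b * ?P) + cs \<kappa> b * y j - \<omega>' * y j"
    by (simp add: algebra_simps)
  have loop_start: "sn \<kappa> b * start_slope g y j Up = \<omega> * y j - cs \<kappa> b * y j - ?P"
    using sn_b by (simp add: up_slope_def dirichlet_slope_def)
  have "sn \<kappa> b * (start_slope g y j Up - V)
    = (\<omega> + \<omega>' - 2 * cs \<kappa> b) * y j - (?P + \<omega>' * (sn \<kappa> b * ?Q - cs \<kappa> b * ?P))"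
    unfolding right_diff_distrib loop_start loop_end by (simp add: algebra_simps)
  then have loop_flux: "start_slope g y j Up - V
    = (2 * (of_real (cos \<theta>) - cs \<kappa> b) * y j - (?P + \<omega>' * (sn \<kappa> b * ?Q - cs \<kappa> b * ?P))) / sn \<kappa> b"
    using sn_b unfolding phase_sum by (simp add: eq_divide_eq mult.commute right_diff_distrib)
  have "sn \<kappa> a * (- H + start_slope g y (j + 1) Hor + start_slope g y j Up - V - of_real c * y j)
    = - (sn \<kappa> a * H) + sn \<kappa> a * start_slope g y (j + 1) Hor
      + sn \<kappa> a * (start_slope g y j Up - V) - of_real c * sn \<kappa> a * y j"
    by (simp add: algebra_simps)
  also have "\<dots> = y (j + 1) + y (j - 1) - 2 * discriminant a b (cos \<theta>) c \<kappa> * y j - graph_source g j"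
    unfolding hor_end hor_start loop_flux discriminant_def graph_source_def
    by (simp add: algebra_simps diff_divide_distrib add_divide_distrib)
  finally show ?thesis by (simp only: H_def V_def)
qed

definition has_edge_data :: "graph_fun \<Rightarrow> graph_fun \<Rightarrow>
    (int \<Rightarrow> etype \<Rightarrow> complex) \<Rightarrow> (int \<Rightarrow> etype \<Rightarrow> complex) \<Rightarrow> bool" where
  "has_edge_data g \<psi> u s \<longleftrightarrow> (\<forall>j e. \<forall>t\<in>{0..elen a b e}.
     \<psi> j e t = edge_sol \<kappa> (g j e) (u j e) (s j e) t \<and>
     dv (elen a b e) (\<psi> j e) t = edge_sol' \<kappa> (g j e) (u j e) (s j e) t)"

lemma has_edge_data_if_H2sol:
  assumes g: "\<And>j e. sqint (elen a b e) (g j e)"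
    and \<psi>: "\<And>j e. H2sol (elen a b e) (\<psi> j e) (\<lambda>t. - (g j e t + \<kappa>\<^sup>2 * \<psi> j e t))"
  shows "has_edge_data g \<psi> (\<lambda>j e. \<psi> j e 0) (\<lambda>j e. dv (elen a b e) (\<psi> j e) 0)"
  unfolding has_edge_data_def
proof (intro allI ballI)
  fix j e t assume t: "t \<in> {0..elen a b e}"
  have zero: "0 \<in> {0..elen a b e}" using elen_pos[of e] by simp
  obtain u' where u': "helmholtz \<kappa> (elen a b e) (g j e) (\<psi> j e) u'"
    using \<psi> unfolding H2sol_iff_helmholtz[OF g] by blast
  note dv = helmholtz_dv[OF u' _ elen_pos]
  show "\<psi> j e t = edge_sol \<kappa> (g j e) (\<psi> j e 0) (dv (elen a b e) (\<psi> j e) 0) t \<and>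
     dv (elen a b e) (\<psi> j e) t = edge_sol' \<kappa> (g j e) (\<psi> j e 0) (dv (elen a b e) (\<psi> j e) 0) t"
    unfolding dv[OF zero] dv[OF t] using helmholtz_eq_edge_sol[OF \<kappa>_nonzero g u' t] by blast
qed

lemma continuity_iff_start_data:
  fixes u s :: "int \<Rightarrow> etype \<Rightarrow> complex" and g y
  assumes y: "\<And>j. u j Up = y j"
  defines "E \<equiv> \<lambda>j e. edge_sol \<kappa> (g j e) (u j e) (s j e)"
    and "E' \<equiv> \<lambda>j e. edge_sol' \<kappa> (g j e) (u j e) (s j e)"
  shows "(\<forall>j. E j Hor a = u (j + 1) Hor \<and> u (j + 1) Hor = y j \<and> y j = E j Dn (b/2) \<and>
      E j Up (b/2) = \<omega> * u j Dn \<and> E' j Up (b/2) = \<omega> * s j Dn)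
    \<longleftrightarrow> u = start_value g y \<and> s = start_slope g y" (is "(\<forall>j. ?cont j) \<longleftrightarrow> ?data")
proof
  assume cont: "\<forall>j. ?cont j"
  have hor: "u j Hor = y (j - 1)" for j using cont[rule_format, of "j - 1"] by simp
  have hor_slope: "s j Hor = dirichlet_slope \<kappa> a (response g j Hor) (y (j - 1)) (y j)" for j
    using cont[rule_format, of j] hor sn_a
    by (simp add: E_def edge_sol_end(1)[of g j Hor, simplified] flip: dirichlet_slope_iff)
  have dn: "u j Dn = \<omega>' * edge_sol \<kappa> (g j Up) (y j) (s j Up) (b/2)"
    and dn_slope: "s j Dn = \<omega>' * edge_sol' \<kappa> (g j Up) (y j) (s j Up) (b/2)" for j
    using conjunct2[OF conjunct2[OF conjunct2[OF cont[rule_format, of j]]]]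
    by (simp_all add: E_def E'_def y)
  have up_slope: "s j Up = up_slope g y j" for j
  proof -
    have "\<omega> * y j = \<omega> * edge_sol \<kappa> (g j Dn) (u j Dn) (s j Dn) (b/2)"
      using cont[rule_format, of j] by (simp add: E_def)
    also have "\<dots> = loop_response g j + y j * cs \<kappa> b + s j Up * sn \<kappa> b"
      unfolding dn dn_slope by (rule loop_end(1))
    finally show ?thesis using sn_b unfolding up_slope_def by (simp flip: dirichlet_slope_iff)
  qed
  have "u j e = start_value g y j e" "s j e = start_slope g y j e" for j e
    by (cases e; simp add: y hor dn up_slope hor_slope dn_slope)+
  then show ?data by blast
next
  assume data: ?data
  show "\<forall>j. ?cont j"
  proof
    fix j
    have "response g j Hor + y (j - 1) * cs \<kappa> a + start_slope g y j Hor * sn \<kappa> a = y j"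
      using sn_a by (simp add: dirichlet_slope_iff)
    moreover
    have "\<omega> * edge_sol \<kappa> (g j Dn) (start_value g y j Dn) (start_slope g y j Dn) (b/2) = \<omega> * y j"
      unfolding start_value.simps start_slope.simps loop_end(1) using sn_b
      by (simp add: dirichlet_slope_iff up_slope_def)
    ultimately show "?cont j"
      using data by (simp add: E_def E'_def edge_sol_end(1)[of g j Hor, simplified])
  qed
qed

lemma vertex_conds_iff:
  assumes data: "has_edge_data g \<psi> u s" and y: "\<And>j. u j Up = y j"
  shows "vertex_conds a b c \<theta> \<psi> \<longleftrightarrow> u = start_value g y \<and> s = start_slope g y \<and> vertex_equation c g y"
proof -
  define E where "E j e = edge_sol \<kappa> (g j e) (u j e) (s j e)" for j e
  define E' where "E' j e = edge_sol' \<kappa> (g j e) (u j e) (s j e)" for j e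
  have ends: "\<psi> j e 0 = u j e" "dv (elen a b e) (\<psi> j e) 0 = s j e"
    "\<psi> j e (elen a b e) = E j e (elen a b e)"
    "dv (elen a b e) (\<psi> j e) (elen a b e) = E' j e (elen a b e)" for j e
    using data elen_pos[of e] by (simp_all add: has_edge_data_def E_def E'_def)
  note ends = ends[where e = Hor, simplified] ends[where e = Up, simplified]
    ends[where e = Dn, simplified]
  define flux where "flux j \<longleftrightarrow>
    - E' j Hor a + s (j + 1) Hor + s j Up - E' j Dn (b/2) = of_real (c j) * y j" for j
  have "vertex_conds a b c \<theta> \<psi> \<longleftrightarrow>
      (\<forall>j. E j Hor a = u (j + 1) Hor \<and> u (j + 1) Hor = y j \<and> y j = E j Dn (b/2) \<and>
        E j Up (b/2) = \<omega> * u j Dn \<and> E' j Up (b/2) = \<omega> * s j Dn) \<and> (\<forall>j. flux j)"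
    unfolding vertex_conds_def ends y flux_def by blast
  also have "\<dots> \<longleftrightarrow> (u = start_value g y \<and> s = start_slope g y) \<and> (\<forall>j. flux j)"
    unfolding E_def E'_def continuity_iff_start_data[where u = u and y = y, OF y] ..
  also have "\<dots> \<longleftrightarrow> (u = start_value g y \<and> s = start_slope g y) \<and> vertex_equation c g y"
  proof (intro conj_cong refl)
    assume "u = start_value g y \<and> s = start_slope g y"
    then have "sn \<kappa> a * (- E' j Hor a + s (j + 1) Hor + s j Up - E' j Dn (b/2) - of_real (c j) * y j)
      = y (j + 1) + y (j - 1) - 2 * discriminant a b (cos \<theta>) (c j) \<kappa> * y j - graph_source g j" for j
      unfolding E'_def by (simp only: flux_graph_sol)
    then have "flux j \<longleftrightarrow>
      y (j + 1) + y (j - 1) - 2 * discriminant a b (cos \<theta>) (c j) \<kappa> * y j = graph_source g j" for j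
      using sn_a unfolding flux_def by (metis eq_iff_diff_eq_0 mult_eq_0_iff)
    then show "(\<forall>j. flux j) \<longleftrightarrow> vertex_equation c g y" by (simp add: three_term_def)
  qed
  finally show ?thesis by simp
qed

lemma summable_data_norm2:
  assumes "L2g a b g" "ell2 \<alpha>" "ell2 \<beta>"
  shows "(\<lambda>j. data_norm2 (elen a b e) (g j e) (\<alpha> j) (\<beta> j)) summable_on UNIV"
  using assms by (auto simp: data_norm2_def L2g_iff ell2_def intro!: summable_on_add)

lemma ell2_edge_sol_end:
  assumes g: "L2g a b g" and \<alpha>: "ell2 \<alpha>" and \<beta>: "ell2 \<beta>"
  shows "ell2 (\<lambda>j. edge_sol \<kappa> (g j e) (\<alpha> j) (\<beta> j) (elen a b e))"
    and "ell2 (\<lambda>j. edge_sol' \<kappa> (g j e) (\<alpha> j) (\<beta> j) (elen a b e))"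
proof -
  obtain K where K:
    "\<And>g \<alpha> \<beta> t. sqint (elen a b e) g \<Longrightarrow> t \<in> {0..elen a b e} \<Longrightarrow>
      (cmod (edge_sol \<kappa> g \<alpha> \<beta> t))\<^sup>2 \<le> K * data_norm2 (elen a b e) g \<alpha> \<beta>"
    "\<And>g \<alpha> \<beta> t. sqint (elen a b e) g \<Longrightarrow> t \<in> {0..elen a b e} \<Longrightarrow>
      (cmod (edge_sol' \<kappa> g \<alpha> \<beta> t))\<^sup>2 \<le> K * data_norm2 (elen a b e) g \<alpha> \<beta>"
    using edge_sol_bound[where \<kappa> = \<kappa> and l = "elen a b e"] by metis
  have sum: "(\<lambda>j. K * data_norm2 (elen a b e) (g j e) (\<alpha> j) (\<beta> j)) summable_on UNIV"
    by (intro summable_on_cmult_right summable_data_norm2 assms)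
  have g': "sqint (elen a b e) (g j e)" for j using g by (simp add: L2g_iff)
  have end': "elen a b e \<in> {0..elen a b e}" using elen_pos[of e] by simp
  show "ell2 (\<lambda>j. edge_sol \<kappa> (g j e) (\<alpha> j) (\<beta> j) (elen a b e))"
    by (rule ell2_comparison[OF sum K(1)[OF g' end']])
  show "ell2 (\<lambda>j. edge_sol' \<kappa> (g j e) (\<alpha> j) (\<beta> j) (elen a b e))"
    by (rule ell2_comparison[OF sum K(2)[OF g' end']])
qed

lemma ell2_zero: "ell2 (\<lambda>_. 0)"
  by (simp add: ell2_def)

lemma ell2_responses:
  assumes g: "L2g a b g"
  shows "ell2 (\<lambda>j. response g j e)" "ell2 (\<lambda>j. response' g j e)"
    and "ell2 (loop_response g)" "ell2 (loop_response' g)"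
proof -
  show R: "ell2 (\<lambda>j. response g j e)" "ell2 (\<lambda>j. response' g j e)" for e
    unfolding response_def response'_def by (rule ell2_edge_sol_end[OF g ell2_zero ell2_zero])+
  show "ell2 (loop_response g)" "ell2 (loop_response' g)"
    unfolding loop_response_def[abs_def] loop_response'_def[abs_def]
    by (intro ell2_add ell2_diff ell2_cmult R)+
qed

lemma ell2_graph_source: "L2g a b g \<Longrightarrow> ell2 (graph_source g)"
  unfolding graph_source_def[abs_def]
  by (intro ell2_add ell2_diff ell2_cmult ell2_responses ell2_shift)

lemma ell2_dirichlet_slope:
  assumes "ell2 p" "ell2 y0" "ell2 y1"
  shows "ell2 (\<lambda>j. dirichlet_slope \<kappa> l (p j) (y0 j) (y1 j))"
proof -
  have "ell2 (\<lambda>j. 1 / sn \<kappa> l * (y1 j - cs \<kappa> l * y0 j - p j))" by (intro ell2_cmult ell2_diff assms)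
  then show ?thesis by (simp add: dirichlet_slope_def)
qed

lemma ell2_start_data:
  assumes g: "L2g a b g" and y: "ell2 y"
  shows "ell2 (\<lambda>j. start_value g y j e)" "ell2 (\<lambda>j. start_slope g y j e)"
proof -
  have y_prev: "ell2 (\<lambda>j. y (j - 1))" using ell2_shift[OF y, of "-1"] by simp
  have up: "ell2 (up_slope g y)"
    unfolding up_slope_def[abs_def] by (intro ell2_dirichlet_slope ell2_cmult ell2_responses g y)
  note up_end = ell2_edge_sol_end[OF g y up, of Up, simplified]
  show "ell2 (\<lambda>j. start_value g y j e)" by (cases e) (simp_all add: y y_prev ell2_cmult up_end)
  show "ell2 (\<lambda>j. start_slope g y j e)"
    by (cases e) (simp_all add: up ell2_cmult up_end ell2_dirichlet_slope ell2_responses g y y_prev)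
qed

lemma L2g_graph_sol:
  assumes g: "L2g a b g" and y: "ell2 y"
  shows "L2g a b (graph_sol g y)"
  unfolding L2g_iff
proof (intro conjI allI)
  fix e
  have g': "sqint (elen a b e) (g j e)" for j using g by (simp add: L2g_iff)
  show "sqint (elen a b e) (graph_sol g y j e)" for j
    unfolding graph_sol_def by (rule sqint_edge_sol[OF \<kappa>_nonzero g'])
  obtain K where K: "\<And>g \<alpha> \<beta>. sqint (elen a b e) g \<Longrightarrow>
      edge_norm2 (elen a b e) (edge_sol \<kappa> g \<alpha> \<beta>) \<le> K * data_norm2 (elen a b e) g \<alpha> \<beta>"
    using edge_norm2_edge_sol_le[OF \<kappa>_nonzero less_imp_le[OF elen_pos[of e]]] by metis
  have "(\<lambda>j. K * data_norm2 (elen a b e) (g j e) (start_value g y j e) (start_slope g y j e))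
      summable_on UNIV"
    by (intro summable_on_cmult_right summable_data_norm2 ell2_start_data g y)
  then show "(\<lambda>j. edge_norm2 (elen a b e) (graph_sol g y j e)) summable_on UNIV"
    by (rule summable_on_comparison_test) (simp_all add: graph_sol_def K[OF g'] edge_norm2_nonneg)
qed

lemma solves_graph_sol:
  assumes g: "L2g a b g" and y: "ell2 y" "vertex_equation c g y"
  shows "solves a b c \<theta> (\<kappa>\<^sup>2) (graph_sol g y) g"
  unfolding solves_def
proof (intro conjI allI)
  have g': "sqint (elen a b e) (g j e)" for j e using g by (simp add: L2g_iff)
  have helmholtz: "helmholtz \<kappa> (elen a b e) (g j e) (graph_sol g y j e)
      (edge_sol' \<kappa> (g j e) (start_value g y j e) (start_slope g y j e))" for j e
    unfolding graph_sol_def by (rule helmholtz_edge_sol[OF \<kappa>_nonzero g'])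
  show "L2g a b (graph_sol g y)" by (rule L2g_graph_sol[OF g y(1)])
  show "H2sol (elen a b e) (graph_sol g y j e) (\<lambda>t. - (g j e t + \<kappa>\<^sup>2 * graph_sol g y j e t))" for j e
    using helmholtz unfolding H2sol_iff_helmholtz[OF g'] by blast
  have "has_edge_data g (graph_sol g y) (start_value g y) (start_slope g y)"
    unfolding has_edge_data_def using helmholtz_dv[OF helmholtz _ elen_pos] by (simp add: graph_sol_def)
  then show "vertex_conds a b c \<theta> (graph_sol g y)" using y(2) by (simp add: vertex_conds_iff)
qed

lemma ell2_vertex_values:
  assumes g: "L2g a b g" and \<psi>: "L2g a b \<psi>" and data: "has_edge_data g \<psi> u s"
  shows "ell2 (\<lambda>j. u j e)"
proof -
  obtain K where K: "\<And>g \<alpha> \<beta>. sqint (elen a b e) g \<Longrightarrow>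
      (cmod \<alpha>)\<^sup>2 \<le> K * (edge_norm2 (elen a b e) g + edge_norm2 (elen a b e) (edge_sol \<kappa> g \<alpha> \<beta>))"
    using initial_value_le[OF \<kappa>_nonzero elen_pos[of e]] by metis
  show ?thesis
  proof (rule ell2_comparison)
    show "(\<lambda>j. K * (edge_norm2 (elen a b e) (g j e) + edge_norm2 (elen a b e) (\<psi> j e)))
        summable_on UNIV"
      using g \<psi> by (auto simp: L2g_iff intro!: summable_on_cmult_right summable_on_add)
    fix j
    have "edge_norm2 (elen a b e) (\<psi> j e)
      = edge_norm2 (elen a b e) (edge_sol \<kappa> (g j e) (u j e) (s j e))"
      using data by (intro edge_norm2_cong) (simp add: has_edge_data_def)
    then show "(cmod (u j e))\<^sup>2
      \<le> K * (edge_norm2 (elen a b e) (g j e) + edge_norm2 (elen a b e) (\<psi> j e))"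
      using K[of "g j e" "u j e" "s j e"] g by (simp add: L2g_iff)
  qed
qed

lemma solves_imp_graph_sol:
  fixes \<psi> g c
  assumes g: "L2g a b g" and \<psi>: "solves a b c \<theta> (\<kappa>\<^sup>2) \<psi> g"
  defines "y \<equiv> \<lambda>j. \<psi> j Up 0"
  shows "ell2 y" and "vertex_equation c g y"
    and "t \<in> {0..elen a b e} \<Longrightarrow> \<psi> j e t = graph_sol g y j e t"
proof -
  define s where "s j e = dv (elen a b e) (\<psi> j e) 0" for j e
  have data: "has_edge_data g \<psi> (\<lambda>j e. \<psi> j e 0) s"
    unfolding s_def using g \<psi> by (intro has_edge_data_if_H2sol) (auto simp: L2g_iff solves_def)
  show "ell2 y"
    unfolding y_def using \<psi> by (intro ell2_vertex_values[OF g _ data]) (simp add: solves_def)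
  have "(\<lambda>j e. \<psi> j e 0) = start_value g y \<and> s = start_slope g y \<and> vertex_equation c g y"
    using \<psi> unfolding solves_def by (subst vertex_conds_iff[OF data, symmetric]) (simp_all add: y_def)
  then show "vertex_equation c g y" "t \<in> {0..elen a b e} \<Longrightarrow> \<psi> j e t = graph_sol g y j e t"
    using data by (auto simp: has_edge_data_def graph_sol_def fun_eq_iff)
qed

end

section \<open>Spectrum outside and inside the bands\<close>

lemma discriminant_coup:
  "(\<lambda>j. discriminant a b \<tau> (coup \<gamma> \<gamma>t j) \<kappa>)
    = (\<lambda>_. discriminant a b \<tau> \<gamma> \<kappa>)(0 := discriminant a b \<tau> \<gamma>t \<kappa>)"
  by (simp add: coup_def fun_eq_iff)

lemma helmholtz_if_twice_differentiable:
  assumes "\<And>t. t \<in> {0..l} \<Longrightarrow> (u has_vector_derivative u' t) (at t within {0..l})"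
    and "\<And>t. t \<in> {0..l} \<Longrightarrow> (u' has_vector_derivative u'' t) (at t within {0..l})"
    and "continuous_on {0..l} u''"
  shows "helmholtz \<kappa> l (\<lambda>t. - (u'' t + \<kappa>\<^sup>2 * u t)) u u'"
  unfolding helmholtz_def
proof (intro conjI ballI)
  fix t assume t: "t \<in> {0..l}"
  have "continuous_on {0..l} (\<lambda>t. - (u'' t + \<kappa>\<^sup>2 * u t))"
    by (intro continuous_intros assms(3) continuous_on_if_has_vector_derivative[OF assms(1)])
  from has_vector_derivative_add[OF assms(2)[OF t] prim_has_vector_derivative[OF this t]]
  show "((\<lambda>s. u' s + prim (\<lambda>t. - (u'' t + \<kappa>\<^sup>2 * u t)) s) has_vector_derivative - \<kappa>\<^sup>2 * u t)
      (at t within {0..l})"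
    by simp
qed (rule assms(1))

text \<open>The source is chosen such that the solution with zero initial data is \<open>t\<^sup>2 (t - l) / l\<^sup>2\<close>.\<close>

lemma unit_end_slope_source:
  assumes \<kappa>: "\<kappa> \<noteq> 0" and l: "l > 0"
  obtains g where "continuous_on {0..l} g" "edge_sol \<kappa> g 0 0 l = 0" "edge_sol' \<kappa> g 0 0 l = 1"
proof -
  define L where "L = complex_of_real l"
  define v v' v'' where "v t = (of_real t ^ 3 - L * (of_real t)\<^sup>2) / L\<^sup>2"
    and "v' t = (3 * (of_real t)\<^sup>2 - 2 * L * of_real t) / L\<^sup>2"
    and "v'' t = (6 * of_real t - 2 * L) / L\<^sup>2" for t
  define g where "g t = - (v'' t + \<kappa>\<^sup>2 * v t)" for t
  have L: "L \<noteq> 0" using l by (simp add: L_def)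
  have deriv: "(v has_vector_derivative v' t) (at t within A)" for t A
    unfolding v_def[abs_def] v'_def
    by (rule has_vector_derivative_real_field[where f = "\<lambda>z. (z ^ 3 - L * z\<^sup>2) / L\<^sup>2"])
      (use L in \<open>auto intro!: derivative_eq_intros simp: field_simps\<close>)
  have deriv': "(v' has_vector_derivative v'' t) (at t within A)" for t A
    unfolding v'_def[abs_def] v''_def
    by (rule has_vector_derivative_real_field[where f = "\<lambda>z. (3 * z\<^sup>2 - 2 * L * z) / L\<^sup>2"])
      (use L in \<open>auto intro!: derivative_eq_intros simp: field_simps\<close>)
  have v'': "continuous_on {0..l} v''"
    unfolding v''_def[abs_def] using L by (intro continuous_intros) auto
  have g: "continuous_on {0..l} g"
    unfolding g_def[abs_def]
    by (intro continuous_intros v'' continuous_on_if_has_vector_derivative[OF deriv])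
  have helmholtz: "helmholtz \<kappa> l g v v'"
    unfolding g_def[abs_def] by (rule helmholtz_if_twice_differentiable[OF deriv deriv' v''])
  have start: "v 0 = 0" "v' 0 = 0" by (simp_all add: v_def v'_def)
  have end': "v l = 0" "v' l = 1"
    using L by (simp_all add: v_def v'_def L_def[symmetric] field_simps power2_eq_square power3_eq_cube)
  have "v l = edge_sol \<kappa> g 0 0 l" "v' l = edge_sol' \<kappa> g 0 0 l"
    using helmholtz_eq_edge_sol[OF \<kappa> sqint_if_continuous_on[OF g] helmholtz, of l] l start by simp_all
  then show thesis using that[OF g] end' by simp
qed

context comb
begin

abbreviation F :: "real \<Rightarrow> complex" where "F \<equiv> \<lambda>\<gamma>. discriminant a b (cos \<theta>) \<gamma> \<kappa>"
abbreviation zero_source :: graph_fun where "zero_source \<equiv> \<lambda>_ _ _. 0"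

lemma L2g_zero_source: "L2g a b zero_source"
  by (auto simp: L2g_iff edge_norm2_def intro: sqint_if_continuous_on)

lemma zero_source_simps [simp]:
  "response zero_source j e = 0" "response' zero_source j e = 0"
  "loop_response zero_source j = 0" "loop_response' zero_source j = 0" "graph_source zero_source j = 0"
  by (simp_all add: response_def response'_def loop_response_def loop_response'_def graph_source_def
      edge_sol_homogeneous)

lemma graph_sol_zero_source_cmult:
  "graph_sol zero_source (\<lambda>j. x * y j) j e t = x * graph_sol zero_source y j e t"
proof -
  have "up_slope zero_source (\<lambda>j. x * y j) j = x * up_slope zero_source y j"
    by (simp add: up_slope_def dirichlet_slope_def right_diff_distrib mult_ac)
  then have "start_value zero_source (\<lambda>j. x * y j) j e = x * start_value zero_source y j e"
    "start_slope zero_source (\<lambda>j. x * y j) j e = x * start_slope zero_source y j e"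
    by (cases e; simp add: edge_sol_homogeneous dirichlet_slope_def algebra_simps)+
  then show ?thesis by (simp add: graph_sol_def edge_sol_homogeneous algebra_simps)
qed

lemma homogeneous_solution:
  assumes z: "decay_root (F \<gamma>) z" and \<psi>: "solves a b (coup \<gamma> \<gamma>t) \<theta> (\<kappa>\<^sup>2) \<psi> zero_source"
  shows "(z - F \<gamma>t) * \<psi> 0 Up 0 = 0"
    and "t \<in> {0..elen a b e} \<Longrightarrow> \<psi> j e t = \<psi> 0 Up 0 * graph_sol zero_source (\<lambda>j. z ^ nat \<bar>j\<bar>) j e t"
proof -
  define y where "y j = \<psi> j Up 0" for j
  have z': "z \<noteq> 0" "cmod z \<le> 1" "z + 1 / z = 2 * F \<gamma>" using z by (simp_all add: decay_root_def)
  note sol = solves_imp_graph_sol[OF L2g_zero_source \<psi>, folded y_def]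
  have "three_term ((\<lambda>_. F \<gamma>)(0 := F \<gamma>t)) ((\<lambda>_. 0)(0 := 0)) y"
    using sol(2) unfolding discriminant_coup by (simp add: three_term_def)
  note power = three_term_perturbed_eq_power_abs[OF z' sol(1) this]
  show "(z - F \<gamma>t) * \<psi> 0 Up 0 = 0" using power(2) by (simp add: y_def)
  have "y = (\<lambda>j. y 0 * z ^ nat \<bar>j\<bar>)" by (rule ext) (subst power(1), rule mult.commute)
  then show "\<psi> j e t = \<psi> 0 Up 0 * graph_sol zero_source (\<lambda>j. z ^ nat \<bar>j\<bar>) j e t"
    if "t \<in> {0..elen a b e}"
    using sol(3)[OF that, of j] graph_sol_zero_source_cmult[of "y 0" "\<lambda>j. z ^ nat \<bar>j\<bar>" j e t]
    by (simp add: y_def)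
qed

lemma not_in_specH:
  assumes z: "decay_root (F \<gamma>) z" and ne: "F \<gamma>t \<noteq> z"
  shows "\<kappa>\<^sup>2 \<notin> specH a b (coup \<gamma> \<gamma>t) \<theta>"
proof -
  have "\<exists>\<psi>. solves a b (coup \<gamma> \<gamma>t) \<theta> (\<kappa>\<^sup>2) \<psi> g" if g: "L2g a b g" for g
  proof -
    obtain y where "ell2 y" "three_term ((\<lambda>_. F \<gamma>)(0 := F \<gamma>t)) (graph_source g) y"
      by (rule three_term_perturbed_solvable[OF z ne ell2_graph_source[OF g]]) (rule that)
    then show ?thesis
      using solves_graph_sol[OF g, where c = "coup \<gamma> \<gamma>t", unfolded discriminant_coup] by blast
  qed
  moreover have "zero_on_edges a b \<psi>" if "solves a b (coup \<gamma> \<gamma>t) \<theta> (\<kappa>\<^sup>2) \<psi> zero_source" for \<psi>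
    using homogeneous_solution[OF z that] ne by (simp add: zero_on_edges_def)
  ultimately show ?thesis by (simp add: specH_def)
qed

lemma decaying_eigenfunction:
  assumes z: "decay_root (F \<gamma>) z" and eq: "F \<gamma>t = z"
  shows "graph_sol zero_source (\<lambda>j. z ^ nat \<bar>j\<bar>) \<in> eigsp a b (coup \<gamma> \<gamma>t) \<theta> (\<kappa>\<^sup>2)"
    and "\<not> zero_on_edges a b (graph_sol zero_source (\<lambda>j. z ^ nat \<bar>j\<bar>))"
proof -
  let ?\<phi> = "graph_sol zero_source (\<lambda>j. z ^ nat \<bar>j\<bar>)"
  have z': "z \<noteq> 0" "cmod z < 1" "z + 1 / z = 2 * F \<gamma>" using z by (simp_all add: decay_root_def)
  have "three_term ((\<lambda>_. F \<gamma>)(0 := F \<gamma>t)) (graph_source zero_source) (\<lambda>j. z ^ nat \<bar>j\<bar>)"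
    using three_term_power_abs[OF z'(1,3), of "F \<gamma>t"] eq by (simp add: three_term_def)
  then show "?\<phi> \<in> eigsp a b (coup \<gamma> \<gamma>t) \<theta> (\<kappa>\<^sup>2)"
    using solves_graph_sol[OF L2g_zero_source ell2_power_abs[OF z'(2)]]
    by (simp add: eigsp_def discriminant_coup)
  have "?\<phi> 0 Up 0 = 1" "0 \<in> {0..elen a b Up}" using b_pos by (simp_all add: graph_sol_def)
  then show "\<not> zero_on_edges a b ?\<phi>" unfolding zero_on_edges_def by (metis zero_neq_one)
qed

lemma eigsp_spanned_by_one:
  assumes z: "decay_root (F \<gamma>) z" and eq: "F \<gamma>t = z"
  shows "\<exists>B. finite B \<and> B \<subseteq> eigsp a b (coup \<gamma> \<gamma>t) \<theta> (\<kappa>\<^sup>2) \<and>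
    (\<forall>\<psi>\<in>eigsp a b (coup \<gamma> \<gamma>t) \<theta> (\<kappa>\<^sup>2).
      \<exists>co. \<forall>j e. \<forall>t\<in>{0..elen a b e}. \<psi> j e t = (\<Sum>\<phi>\<in>B. co \<phi> * \<phi> j e t))"
proof (intro exI[of _ "{graph_sol zero_source (\<lambda>j. z ^ nat \<bar>j\<bar>)}"] conjI ballI)
  fix \<psi> assume "\<psi> \<in> eigsp a b (coup \<gamma> \<gamma>t) \<theta> (\<kappa>\<^sup>2)"
  then have "solves a b (coup \<gamma> \<gamma>t) \<theta> (\<kappa>\<^sup>2) \<psi> zero_source" by (simp add: eigsp_def)
  from homogeneous_solution(2)[OF z this]
  show "\<exists>co. \<forall>j e. \<forall>t\<in>{0..elen a b e}.
      \<psi> j e t = (\<Sum>\<phi>\<in>{graph_sol zero_source (\<lambda>j. z ^ nat \<bar>j\<bar>)}. co \<phi> * \<phi> j e t)"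
    by (intro exI[of _ "\<lambda>_. \<psi> 0 Up 0"]) simp
qed (use decaying_eigenfunction(1)[OF z eq] in auto)

lemma in_specH_iff:
  assumes z: "decay_root (F \<gamma>) z"
  shows "\<kappa>\<^sup>2 \<in> specH a b (coup \<gamma> \<gamma>t) \<theta> \<longleftrightarrow> F \<gamma>t = z"
  using not_in_specH[OF z] decaying_eigenfunction[OF z] unfolding specH_def eigsp_def by blast

lemma point_source_exists:
  obtains g where "L2g a b g" "graph_source g = (\<lambda>_. 0)(0 := sn \<kappa> a)"
proof -
  obtain h where h: "continuous_on {0..b/2} h"
    "edge_sol \<kappa> h 0 0 (b/2) = 0" "edge_sol' \<kappa> h 0 0 (b/2) = 1"
    using b_pos by (rule unit_end_slope_source[OF \<kappa>_nonzero half_gt_zero]) (rule that)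
  define g where "g j e = (if j = (0::int) \<and> e = Dn then h else (\<lambda>_. 0))" for j e
  have norm_zero: "edge_norm2 (elen a b e) (g j e) = 0" if "j \<noteq> 0" for j e
    using that by (simp add: g_def edge_norm2_def)
  have "L2g a b g"
    unfolding L2g_iff
  proof (intro conjI allI)
    show "sqint (elen a b e) (g j e)" for j e
      by (rule sqint_if_continuous_on) (use h(1) in \<open>auto simp: g_def\<close>)
    show "(\<lambda>j. edge_norm2 (elen a b e) (g j e)) summable_on UNIV" for e
      by (subst summable_on_cong_neutral[where T = "{0}" and g = "\<lambda>j. edge_norm2 (elen a b e) (g j e)"])
        (auto simp: norm_zero)
  qed
  moreover have "response g j e = 0" "response' g j e = (if j = 0 \<and> e = Dn then 1 else 0)" for j e
    using h(2,3) by (auto simp: response_def response'_def g_def edge_sol_homogeneous)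
  then have "graph_source g j = ((\<lambda>_. 0)(0 := sn \<kappa> a)) j" for j
    using sn_b by (simp add: graph_source_def loop_response_def loop_response'_def)
  ultimately show thesis by (intro that) blast+
qed

lemma band_in_specH:
  assumes "F \<gamma> \<in> complex_of_real ` {-1..1}"
  shows "\<kappa>\<^sup>2 \<in> specH a b (coup \<gamma> \<gamma>t) \<theta>"
proof (rule ccontr)
  assume not_in: "\<kappa>\<^sup>2 \<notin> specH a b (coup \<gamma> \<gamma>t) \<theta>"
  obtain z where z: "cmod z = 1" "z + 1 / z = 2 * F \<gamma>"
    by (rule unit_root_exists[OF assms]) (rule that)
  then have z': "z \<noteq> 0" "cmod z \<le> 1" by auto
  obtain g where g: "L2g a b g" "graph_source g = (\<lambda>_. 0)(0 := sn \<kappa> a)"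
    by (rule point_source_exists) (rule that)
  obtain \<psi> where \<psi>: "solves a b (coup \<gamma> \<gamma>t) \<theta> (\<kappa>\<^sup>2) \<psi> g"
    using not_in g(1) by (auto simp: specH_def)
  define y where "y j = \<psi> j Up 0" for j
  note sol = solves_imp_graph_sol[OF g(1) \<psi>, folded y_def, unfolded g(2) discriminant_coup]
  note power = three_term_perturbed_eq_power_abs[OF z' z(2) sol(1,2)]
  have "cmod (y (int n)) = cmod (y 0)" for n
    using power(1)[of "int n"] z(1) by (simp add: norm_mult norm_power)
  moreover have "(\<lambda>n. cmod (y (int n))) \<longlonglongrightarrow> 0"
    by (rule tendsto_norm_zero[OF ell2_tendsto_0[OF sol(1)]]) simp
  ultimately have "y 0 = 0" by (simp add: LIMSEQ_const_iff)
  then show False using power(2) sn_a by simp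
qed

end

section \<open>Isolation of the eigenvalue\<close>

definition secular :: "real \<Rightarrow> real \<Rightarrow> real \<Rightarrow> real \<Rightarrow> real \<Rightarrow> complex \<Rightarrow> complex" where
  "secular a b \<tau> \<gamma> \<gamma>t \<kappa> =
     (discriminant a b \<tau> \<gamma>t \<kappa>)\<^sup>2 - 2 * discriminant a b \<tau> \<gamma> \<kappa> * discriminant a b \<tau> \<gamma>t \<kappa> + 1"

lemma secular_eq_0:
  assumes "decay_root (discriminant a b \<tau> \<gamma> \<kappa>) (discriminant a b \<tau> \<gamma>t \<kappa>)"
  shows "secular a b \<tau> \<gamma> \<gamma>t \<kappa> = 0"
proof -
  define z where "z = discriminant a b \<tau> \<gamma>t \<kappa>"
  have z: "z \<noteq> 0" "2 * discriminant a b \<tau> \<gamma> \<kappa> = z + 1 / z"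
    using assms by (simp_all add: z_def decay_root_def)
  show ?thesis
    unfolding secular_def z_def[symmetric] z(2) using z(1) by (simp add: field_simps power2_eq_square)
qed

lemma discriminant_meromorphic: "discriminant a b \<tau> \<gamma> meromorphic_on A"
  unfolding discriminant_def[abs_def] cs_def sn_def
  by (intro meromorphic_intros analytic_on_imp_meromorphic_on) (intro analytic_intros)+

lemma discriminant_isCont:
  assumes "\<kappa> \<noteq> 0" "sn \<kappa> b \<noteq> 0"
  shows "isCont (discriminant a b \<tau> \<gamma>) \<kappa>"
proof -
  have "isCont (\<lambda>\<kappa>. sn \<kappa> t) \<kappa>" "isCont (\<lambda>\<kappa>. cs \<kappa> t) \<kappa>" for t
    unfolding sn_def cs_def using assms(1) by (intro continuous_intros; simp)+
  then show ?thesis unfolding discriminant_def[abs_def] using assms(2) by (intro continuous_intros) auto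
qed

lemma cs_imaginary: "cs (\<i> * of_real t) x = of_real (cosh (t * x))"
  unfolding cs_def mult.assoc of_real_mult[symmetric] by (simp only: cosh_field_def exp_minus cosh_real)

lemma sn_imaginary: "sn (\<i> * of_real t) x = of_real (sinh (t * x) / t)"
proof -
  have "complex_of_real (sinh (t * x)) = - \<i> * sin (\<i> * of_real (t * x))"
    by (simp only: sinh_field_def exp_minus sinh_real)
  then show ?thesis by (cases "t = 0") (simp_all add: sn_def mult.assoc field_simps)
qed

lemma discriminant_imaginary_limit:
  assumes a: "a > 0" and b: "b > 0"
  shows "((\<lambda>t. discriminant a b \<tau> \<gamma> (\<i> * of_real t) / of_real (sinh (t * a))) \<longlongrightarrow> 2) at_top"
proof -
  define q where "q t = \<gamma> / (2 * t) + cosh (t * a) / sinh (t * a) + (cosh (t * b) - \<tau>) / sinh (t * b)" for t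
  have q: "of_real (q t) = discriminant a b \<tau> \<gamma> (\<i> * of_real t) / of_real (sinh (t * a))" if "t > 0" for t
    using that a b by (simp add: q_def discriminant_def cs_imaginary sn_imaginary field_simps)
  have "(q \<longlongrightarrow> 0 + 1 + 1) at_top"
    unfolding q_def[abs_def]
  proof (intro tendsto_add)
    show "((\<lambda>t. \<gamma> / (2 * t)) \<longlongrightarrow> 0) at_top" by real_asymp
    show "((\<lambda>t. cosh (t * a) / sinh (t * a)) \<longlongrightarrow> 1) at_top" using a by real_asymp
    show "((\<lambda>t. (cosh (t * b) - \<tau>) / sinh (t * b)) \<longlongrightarrow> 1) at_top" using b by real_asymp
  qed
  then have "((\<lambda>t. complex_of_real (q t)) \<longlongrightarrow> of_real (0 + 1 + 1)) at_top" by (rule tendsto_of_real)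
  then have "((\<lambda>t. discriminant a b \<tau> \<gamma> (\<i> * of_real t) / of_real (sinh (t * a)))
      \<longlongrightarrow> of_real (0 + 1 + 1)) at_top"
    by (rule Lim_transform_eventually) (rule eventually_mono[OF eventually_gt_at_top[of 0] q])
  then show ?thesis by simp
qed

lemma secular_nonzero_on_imaginary_axis:
  assumes a: "a > 0" and b: "b > 0"
  shows "\<exists>t>0. secular a b \<tau> \<gamma> \<gamma>t (\<i> * of_real t) \<noteq> 0"
proof -
  define S where "S t = complex_of_real (sinh (t * a))" for t
  define D where "D \<gamma> t = discriminant a b \<tau> \<gamma> (\<i> * of_real t) / S t" for \<gamma> t
  define Q where "Q t = (D \<gamma>t t)\<^sup>2 - 2 * D \<gamma> t * D \<gamma>t t + of_real (1 / (sinh (t * a))\<^sup>2)" for t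
  have "(Q \<longlongrightarrow> 2\<^sup>2 - 2 * 2 * 2 + of_real 0) at_top"
    unfolding Q_def[abs_def] D_def S_def
    by (intro tendsto_intros discriminant_imaginary_limit assms) (use a in real_asymp)
  then have "\<forall>\<^sub>F t in at_top. Q t \<noteq> 0" by (rule tendsto_imp_eventually_ne) simp
  then have "\<forall>\<^sub>F t in at_top. t > 0 \<and> secular a b \<tau> \<gamma> \<gamma>t (\<i> * of_real t) \<noteq> 0"
    using eventually_gt_at_top[of 0]
  proof eventually_elim
    case (elim t)
    then have "S t \<noteq> 0" using a by (simp add: S_def)
    then have "secular a b \<tau> \<gamma> \<gamma>t (\<i> * of_real t) = (S t)\<^sup>2 * Q t"
      by (simp add: secular_def Q_def D_def S_def field_simps power2_eq_square)
    then show ?case using elim \<open>S t \<noteq> 0\<close> by simp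
  qed
  then show ?thesis by (rule eventually_happens'[rotated]) simp
qed

lemma eventually_secular_nonzero:
  assumes a: "a > 0" and b: "b > 0"
  shows "\<forall>\<^sub>F \<kappa> in at \<kappa>0. secular a b \<tau> \<gamma> \<gamma>t \<kappa> \<noteq> 0"
proof -
  have "secular a b \<tau> \<gamma> \<gamma>t meromorphic_on UNIV"
    unfolding secular_def[abs_def] by (intro meromorphic_intros discriminant_meromorphic)
  then consider "\<forall>\<^sub>\<approx>\<kappa>. secular a b \<tau> \<gamma> \<gamma>t \<kappa> = 0" | "\<forall>\<^sub>\<approx>\<kappa>. secular a b \<tau> \<gamma> \<gamma>t \<kappa> \<noteq> 0"
    using meromorphic_imp_constant_or_avoid[of _ UNIV 0] by auto
  then show ?thesis
  proof cases
    case 1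
    obtain t where t: "t > 0" "secular a b \<tau> \<gamma> \<gamma>t (\<i> * of_real t) \<noteq> 0"
      using secular_nonzero_on_imaginary_axis[OF assms] by blast
    have "isCont (secular a b \<tau> \<gamma> \<gamma>t) (\<i> * of_real t)"
      unfolding secular_def[abs_def] using t(1) b
      by (intro continuous_intros discriminant_isCont) (auto simp: sn_imaginary)
    then have "\<forall>\<^sub>F \<kappa> in at (\<i> * of_real t). secular a b \<tau> \<gamma> \<gamma>t \<kappa> \<noteq> 0"
      using t(2) tendsto_imp_eventually_ne unfolding isCont_def by blast
    moreover have "\<forall>\<^sub>F \<kappa> in at (\<i> * of_real t). secular a b \<tau> \<gamma> \<gamma>t \<kappa> = 0"
      by (rule eventually_cosparse_imp_eventually_at[OF 1]) simp
    ultimately have "\<forall>\<^sub>F \<kappa> in at (\<i> * complex_of_real t). False" by eventually_elim simp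
    then show ?thesis by simp
  next
    case 2
    then show ?thesis by (rule eventually_cosparse_imp_eventually_at) simp
  qed
qed

lemma eventually_at_power2:
  assumes "Re k > 0" and P: "\<forall>\<^sub>F \<kappa> in at k. P (\<kappa>\<^sup>2)"
  shows "\<forall>\<^sub>F \<mu> in at (k\<^sup>2). P \<mu>"
proof -
  have csqrt_k: "csqrt (k\<^sup>2) = k" using assms(1) by (simp add: csqrt_square)
  have "filterlim csqrt (at k) (at (k\<^sup>2))"
  proof (rule filterlim_atI)
    have "isCont csqrt (k\<^sup>2)"
    proof (rule continuous_at_csqrt)
      show "k\<^sup>2 \<notin> \<real>\<^sub>\<le>\<^sub>0"
        using assms(1) by (auto simp: complex_nonpos_Reals_iff power2_eq_square mult_le_0_iff)
    qed
    then show "(csqrt \<longlongrightarrow> k) (at (k\<^sup>2))" by (simp add: isCont_def csqrt_k)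
    have "csqrt \<mu> \<noteq> k" if "\<mu> \<noteq> k\<^sup>2" for \<mu> using that by (metis power2_csqrt)
    then show "\<forall>\<^sub>F \<mu> in at (k\<^sup>2). csqrt \<mu> \<noteq> k" by (simp add: eventually_at_filter)
  qed
  from eventually_compose_filterlim[OF P this] show ?thesis by simp
qed

context comb
begin

lemma eventually_not_in_specH:
  assumes \<kappa>: "Re \<kappa> > 0" and gap: "F \<gamma> \<notin> complex_of_real ` {-1..1}"
  shows "\<forall>\<^sub>F \<mu> in at (\<kappa>\<^sup>2). \<mu> \<notin> specH a b (coup \<gamma> \<gamma>t) \<theta>"
proof (rule eventually_at_power2[OF \<kappa>])
  have sn: "isCont (\<lambda>\<kappa>. sn \<kappa> t) \<kappa>" for t
    unfolding sn_def using \<kappa>_nonzero by (intro continuous_intros) simp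
  have "\<forall>\<^sub>F w in at \<kappa>. w \<noteq> 0" "\<forall>\<^sub>F w in at \<kappa>. sn w a \<noteq> 0" "\<forall>\<^sub>F w in at \<kappa>. sn w b \<noteq> 0"
    using tendsto_imp_eventually_ne[OF tendsto_ident_at \<kappa>_nonzero]
      tendsto_imp_eventually_ne[OF sn[unfolded isCont_def] sn_a]
      tendsto_imp_eventually_ne[OF sn[unfolded isCont_def] sn_b] by blast+
  moreover have "\<forall>\<^sub>F w in at \<kappa>. discriminant a b (cos \<theta>) \<gamma> w \<in> - complex_of_real ` {-1..1}"
  proof (rule topological_tendstoD)
    show "(discriminant a b (cos \<theta>) \<gamma> \<longlongrightarrow> F \<gamma>) (at \<kappa>)"
      using discriminant_isCont[OF \<kappa>_nonzero sn_b] by (simp add: isCont_def)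
    show "open (- complex_of_real ` {-1..1})"
      by (intro open_Compl compact_imp_closed compact_continuous_image continuous_intros) auto
  qed (use gap in simp)
  moreover have "\<forall>\<^sub>F w in at \<kappa>. secular a b (cos \<theta>) \<gamma> \<gamma>t w \<noteq> 0"
    by (rule eventually_secular_nonzero[OF a_pos b_pos])
  ultimately show "\<forall>\<^sub>F w in at \<kappa>. w\<^sup>2 \<notin> specH a b (coup \<gamma> \<gamma>t) \<theta>"
  proof eventually_elim
    case (elim w)
    then interpret w: comb a b \<theta> w by unfold_locales (simp_all add: a_pos b_pos)
    obtain z where z: "decay_root (discriminant a b (cos \<theta>) \<gamma> w) z"
      by (rule decay_root_exists) (use elim in auto)
    moreover have "discriminant a b (cos \<theta>) \<gamma>t w \<noteq> z" using z secular_eq_0 elim by blast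
    ultimately show ?case by (rule w.not_in_specH)
  qed
qed

lemma in_disc_specH_iff:
  assumes \<kappa>: "Re \<kappa> > 0" and z: "decay_root (F \<gamma>) z"
  shows "\<kappa>\<^sup>2 \<in> disc_specH a b (coup \<gamma> \<gamma>t) \<theta> \<longleftrightarrow> F \<gamma>t = z"
proof
  assume "\<kappa>\<^sup>2 \<in> disc_specH a b (coup \<gamma> \<gamma>t) \<theta>"
  then show "F \<gamma>t = z" using in_specH_iff[OF z] by (simp add: disc_specH_def)
next
  assume eq: "F \<gamma>t = z"
  have "F \<gamma> \<notin> complex_of_real ` {-1..1}" by (rule decay_root_not_in_band[OF z])
  from eventually_not_in_specH[OF \<kappa> this, of \<gamma>t]
  have "\<exists>\<epsilon>>0. \<forall>\<mu>. \<mu> \<noteq> \<kappa>\<^sup>2 \<and> cmod (\<mu> - \<kappa>\<^sup>2) < \<epsilon> \<longrightarrow> \<mu> \<notin> specH a b (coup \<gamma> \<gamma>t) \<theta>"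
    unfolding eventually_at dist_norm by blast
  then show "\<kappa>\<^sup>2 \<in> disc_specH a b (coup \<gamma> \<gamma>t) \<theta>"
    using in_specH_iff[OF z] eq decaying_eigenfunction[OF z eq] eigsp_spanned_by_one[OF z eq]
    unfolding disc_specH_def by blast
qed

end

lemma discriminant_of_real:
  assumes "k \<noteq> 0" "sin (k * b) \<noteq> 0"
  shows "discriminant a b \<tau> \<gamma> (of_real k) = of_real (ff a b \<gamma> \<tau> k)"
proof -
  have "ff a b \<gamma> \<tau> k =
      \<gamma> * (sin (k * a) / k) / 2 + cos (k * a) + sin (k * a) / k * (cos (k * b) - \<tau>) / (sin (k * b) / k)"
    using assms by (simp add: ff_def distrib_left sin_add field_simps)
  then show ?thesis
    unfolding discriminant_def sn_def cs_def of_real_mult[symmetric] sin_of_real cos_of_real by simp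
qed

theorem theorem3p2:
  fixes a b \<gamma> \<gamma>t \<theta> E k \<tau> :: real
  assumes "a > 0" and "b > 0"
    and "\<theta> \<in> {-pi..pi}"
    and "\<tau> = cos \<theta>"
    and "E > 0"
    and "complex_of_real E \<notin> specHg a b \<gamma> \<gamma> \<theta>"
    and "k = sqrt E"
    and "k \<notin> Xi a b"
  shows "complex_of_real E \<in> disc_specHg a b \<gamma> \<gamma>t \<theta> \<longleftrightarrow>
    (ff a b \<gamma>t \<tau> k =
      (if ff a b \<gamma> \<tau> k < -1 then ff a b \<gamma> \<tau> k + sqrt ((ff a b \<gamma> \<tau> k)^2 - 1)
       else ff a b \<gamma> \<tau> k - sqrt ((ff a b \<gamma> \<tau> k)^2 - 1)))"
proof -
  have k: "k > 0" and E: "complex_of_real E = (of_real k)\<^sup>2"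
    using assms(5,7) by (simp_all flip: of_real_power)
  have sines: "sin (k * a) \<noteq> 0" "sin (k * b) \<noteq> 0" using assms(8) k by (auto simp: Xi_def)
  interpret comb a b \<theta> "of_real k"
    by unfold_locales
      (use assms(1,2) k sines in \<open>auto simp: sn_def sin_of_real simp flip: of_real_mult\<close>)
  have F: "discriminant a b (cos \<theta>) g (of_real k) = of_real (ff a b g \<tau> k)" for g
    unfolding assms(4) by (rule discriminant_of_real) (use k sines in auto)
  have gap: "\<bar>ff a b \<gamma> \<tau> k\<bar> > 1"
    using band_in_specH[of \<gamma> \<gamma>] assms(6) unfolding F specHg_def E by (force simp: abs_if)
  show ?thesis
    using in_disc_specH_iff[OF _ decay_root_of_real[OF gap, folded F], of \<gamma>t] k
    unfolding F E disc_specHg_def of_real_eq_iff by simp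
qed

end
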